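(* Let $n\ge 4$ and $k\ge 1$, let $\tilde R$ be a quiver on $[1,n-1]$ with $b_{ij}(\tilde R)\ge 2$ whenever $i<j$, and let $Q$ be the quiver on $[1,n]$ whose full subquiver on $[1,n-1]$ is obtained from $\tilde R$ by mutating successively at $2,1,2,1,\dots,2,1$ ($2k$ mutations, starting with $2$), and whose entries $b_{in}(Q)\ge 2$ are arbitrary. Let $R$ be the quiver obtained from $Q$ by mutating at $n$ and then successively at $1,2,1,2,\dots,1,2$ ($2k$ mutations). Assume that either $n\ge 5$, or $n=4$ and $b_{14}(Q)\ne b_{23}(R)$. Consider the graph $\Gamma$ whose vertices are the classes of quivers mutation-equivalent to $Q$ modulo the equivalence generated by relabeling vertices and reversing all arrows, with an edge between two classes whenever a representative of one is obtained from a representative of the other by a single mutation. Then the class of $Q$ does not lie on any cycle of $\Gamma$ (closed walk in which no two consecutive edges or vertices coincide) of length $\le 4k+1$, and the image in $\Gamma$ of the mutation cycle of length $4k+n$ based at $Q$ given by mutating successively at $n,\ 1,2,\dots,1,2\ (2k\text{ terms}),\ n-1,\dots,2,1,\ 2,1,\dots,2,1\ (2k\text{ terms})$ cannot be paved by cycles of $\Gamma$ of length $\le 4k+1$.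
   Context: A quiver on $[1,n]$ is a finite directed multigraph with no loops and no oriented 2-cycles; quivers are labeled. It is encoded by the skew-symmetric matrix $B(Q)=(b_{ij})$, $b_{ij}>0$ meaning $b_{ij}$ arrows from $i$ to $j$. Mutation at $k$: $\mu[k](Q)$ has $b'_{ij}=-b_{ij}$ if $k\in\{i,j\}$ and $b'_{ij}=b_{ij}+\tfrac12(|b_{ik}|b_{kj}+b_{ik}|b_{kj}|)$ otherwise. A closed walk in a graph is paved by cycles of length $\le L$ if it becomes null-homotopic in the 2-complex obtained by attaching a 2-cell along every cycle of length $\le L$. *)

theory Defs
  imports "HOL-Analysis.Analysis" "HOL-Combinatorics.Permutations"
begin

section \<open>Quivers and mutation\<close>

text \<open>A labeled quiver on \<open>{1..n}\<close> is identified with its skew-symmetric integer matrix, extended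
  by \<open>0\<close> outside the index set so that equality of quivers is equality of functions.\<close>

type_synonym quiver = "nat \<Rightarrow> nat \<Rightarrow> int"

definition quiver_on :: "nat \<Rightarrow> quiver \<Rightarrow> bool" where
  "quiver_on n B \<longleftrightarrow>
     (\<forall>i j. B i j = - B j i) \<and> (\<forall>i j. i \<notin> {1..n} \<or> j \<notin> {1..n} \<longrightarrow> B i j = 0)"

definition full_subquiver :: "nat set \<Rightarrow> quiver \<Rightarrow> quiver" where
  "full_subquiver I B = (\<lambda>i j. if i \<in> I \<and> j \<in> I then B i j else 0)"

text \<open>The dividend is always even, so \<open>div\<close> is exact.\<close>

definition mutate :: "nat \<Rightarrow> quiver \<Rightarrow> quiver" where
  "mutate k B = (\<lambda>i j.
     if k = i \<or> k = j then - B i j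
     else B i j + (\<bar>B i k\<bar> * B k j + B i k * \<bar>B k j\<bar>) div 2)"

text \<open>Mutations are performed from the head of the list on.\<close>

definition mutate_seq :: "nat list \<Rightarrow> quiver \<Rightarrow> quiver" where
  "mutate_seq ks B = fold mutate ks B"

definition mutation_class :: "nat \<Rightarrow> quiver \<Rightarrow> quiver set" where
  "mutation_class n Q = {mutate_seq ks Q |ks. set ks \<subseteq> {1..n}}"

section \<open>The graph of quivers up to relabeling and global reversal\<close>

definition relabel_or_reverse :: "nat \<Rightarrow> quiver \<Rightarrow> quiver \<Rightarrow> bool" where
  "relabel_or_reverse n P P' \<longleftrightarrow>
     (\<exists>\<sigma>. \<sigma> permutes {1..n} \<and> P' = (\<lambda>i j. P (\<sigma> i) (\<sigma> j))) \<or> P' = (\<lambda>i j. - P i j)"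

text \<open>Classes are taken among all quivers. Since mutation commutes with reversal and (up to renaming
  the mutated vertex) with relabeling, intersecting every class with the mutation class of \<open>Q\<close>
  would yield an isomorphic graph.\<close>

definition quiver_class :: "nat \<Rightarrow> quiver \<Rightarrow> quiver set" where
  "quiver_class n P = {P'. equivclp (relabel_or_reverse n) P P'}"

definition Gamma_verts :: "nat \<Rightarrow> quiver \<Rightarrow> quiver set set" where
  "Gamma_verts n Q = quiver_class n ` mutation_class n Q"

text \<open>An edge is the set of its two endpoints; mutations that do not change the class contribute no
  edge.\<close>

definition Gamma_edges :: "nat \<Rightarrow> quiver \<Rightarrow> quiver set set set" where
  "Gamma_edges n Q =
     {{X, Y} |X Y. X \<in> Gamma_verts n Q \<and> Y \<in> Gamma_verts n Q \<and> X \<noteq> Y \<and>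
                   (\<exists>P\<in>X. \<exists>k\<in>{1..n}. mutate k P \<in> Y)}"

text \<open>The successive quivers met along a sequence of mutations, without the final one.\<close>

definition mutation_path :: "nat list \<Rightarrow> quiver \<Rightarrow> quiver list" where
  "mutation_path ks Q = map (\<lambda>m. mutate_seq (take m ks) Q) [0..<length ks]"

section \<open>Cycles\<close>

text \<open>A closed walk of length \<open>L\<close> is given by the list of its \<open>L\<close> vertices, read cyclically (the
  starting vertex is not repeated at the end).\<close>

definition cyc_nth :: "'v list \<Rightarrow> nat \<Rightarrow> 'v" where
  "cyc_nth w i = w ! (i mod length w)"

text \<open>Consecutiveness of vertices and edges is cyclic, so a cycle has no backtracking at its base point
  either; repetitions further apart are allowed. The trivial walk is not a cycle, and lengths 1 and 2
  are excluded by the conditions.\<close>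

definition graph_cycle :: "'v set set \<Rightarrow> 'v list \<Rightarrow> bool" where
  "graph_cycle E c \<longleftrightarrow> c \<noteq> [] \<and>
     (\<forall>i. {cyc_nth c i, cyc_nth c (i + 1)} \<in> E \<and>
          cyc_nth c i \<noteq> cyc_nth c (i + 1) \<and>
          {cyc_nth c i, cyc_nth c (i + 1)} \<noteq> {cyc_nth c (i + 1), cyc_nth c (i + 2)})"

section \<open>Attaching 2-cells\<close>

text \<open>Points of the 2-complex obtained from a graph by attaching disks along a set of closed walks.
  Points of the graph are given by barycentric coordinates; \<open>Disk_pt c z\<close> with \<open>norm z < 1\<close> is a point
  of the open disk attached along \<open>c\<close>.\<close>

datatype 'v complex_pt = Graph_pt "'v \<Rightarrow> real" | Disk_pt "'v list" complex

definition segment_pt :: "'v \<Rightarrow> 'v \<Rightarrow> real \<Rightarrow> 'v complex_pt" where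
  "segment_pt u v t = Graph_pt (\<lambda>x. (1 - t) * of_bool (x = u) + t * of_bool (x = v))"

text \<open>The loop traced by a closed walk, parametrized by the unit circle, each step taking the same
  amount of time. A step between equal vertices is stationary.\<close>

definition walk_loop :: "'v list \<Rightarrow> complex \<Rightarrow> 'v complex_pt" where
  "walk_loop w z =
     (let s = real (length w) * Arg2pi z / (2 * pi); i = nat \<lfloor>s\<rfloor>
      in segment_pt (cyc_nth w i) (cyc_nth w (i + 1)) (frac s))"

definition cell_map :: "'v list \<Rightarrow> complex \<Rightarrow> 'v complex_pt" where
  "cell_map c z = (if norm z < 1 then Disk_pt c z else walk_loop c z)"

definition complex_points :: "'v set \<Rightarrow> 'v set set \<Rightarrow> 'v list set \<Rightarrow> 'v complex_pt set" where
  "complex_points V E C =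
     {segment_pt v v 0 |v. v \<in> V} \<union>
     {segment_pt u v t |u v t. {u, v} \<in> E \<and> t \<in> {0..1}} \<union>
     {Disk_pt c z |c z. c \<in> C \<and> norm z < 1}"

text \<open>The weak (CW) topology: the final topology for the characteristic maps of the edges and of the
  attached closed disks. The set \<open>C\<close> may contain the same cyclic walk with several base points or
  both directions, so that several disks are attached along it; this does not affect which loops in
  the graph are null-homotopic.\<close>

definition two_complex :: "'v set \<Rightarrow> 'v set set \<Rightarrow> 'v list set \<Rightarrow> 'v complex_pt topology" where
  "two_complex V E C = topology (\<lambda>U.
     U \<subseteq> complex_points V E C \<and>
     (\<forall>u v. {u, v} \<in> E \<longrightarrow>
        openin (top_of_set {0..1}) {t \<in> {0..1}. segment_pt u v t \<in> U}) \<and>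
     (\<forall>c\<in>C. openin (top_of_set (cball 0 1)) {z \<in> cball 0 1. cell_map c z \<in> U}))"

lemma openin_two_complex:
  "openin (two_complex V E C) U \<longleftrightarrow>
     U \<subseteq> complex_points V E C \<and>
     (\<forall>u v. {u, v} \<in> E \<longrightarrow>
        openin (top_of_set {0..1}) {t \<in> {0..1}. segment_pt u v t \<in> U}) \<and>
     (\<forall>c\<in>C. openin (top_of_set (cball 0 1)) {z \<in> cball 0 1. cell_map c z \<in> U})"
proof -
  have U1: "openin (top_of_set {0..1::real}) {t \<in> {0..1}. f t \<in> \<Union>\<K>}"
    if "\<And>S. S \<in> \<K> \<Longrightarrow> openin (top_of_set {0..1}) {t \<in> {0..1}. f t \<in> S}"
    for f :: "real \<Rightarrow> 'v complex_pt" and \<K>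
  proof -
    have "{t \<in> {0..1}. f t \<in> \<Union>\<K>} = \<Union>((\<lambda>S. {t \<in> {0..1}. f t \<in> S}) ` \<K>)" by auto
    then show ?thesis using that by (auto intro!: openin_Union)
  qed
  have U2: "openin (top_of_set (cball 0 1)) {t \<in> cball 0 1. f t \<in> \<Union>\<K>}"
    if "\<And>S. S \<in> \<K> \<Longrightarrow> openin (top_of_set (cball 0 1)) {t \<in> cball 0 1. f t \<in> S}"
    for f :: "complex \<Rightarrow> 'v complex_pt" and \<K>
  proof -
    have "{t \<in> cball 0 1. f t \<in> \<Union>\<K>} = \<Union>((\<lambda>S. {t \<in> cball 0 1. f t \<in> S}) ` \<K>)" by auto
    then show ?thesis using that by (auto intro!: openin_Union)
  qed
  have N1: "openin (top_of_set {0..1::real}) {t \<in> {0..1}. f t \<in> S \<inter> T}"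
    if "openin (top_of_set {0..1}) {t \<in> {0..1}. f t \<in> S}"
       "openin (top_of_set {0..1}) {t \<in> {0..1}. f t \<in> T}"
    for f :: "real \<Rightarrow> 'v complex_pt" and S T
  proof -
    have "{t \<in> {0..1}. f t \<in> S \<inter> T} = {t \<in> {0..1}. f t \<in> S} \<inter> {t \<in> {0..1}. f t \<in> T}" by auto
    then show ?thesis using openin_Int[OF that] by simp
  qed
  have N2: "openin (top_of_set (cball 0 1)) {t \<in> cball 0 1. f t \<in> S \<inter> T}"
    if "openin (top_of_set (cball 0 1)) {t \<in> cball 0 1. f t \<in> S}"
       "openin (top_of_set (cball 0 1)) {t \<in> cball 0 1. f t \<in> T}"
    for f :: "complex \<Rightarrow> 'v complex_pt" and S T
  proof -
    have "{t \<in> cball 0 1. f t \<in> S \<inter> T} = {t \<in> cball 0 1. f t \<in> S} \<inter> {t \<in> cball 0 1. f t \<in> T}"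
      by auto
    then show ?thesis using openin_Int[OF that] by simp
  qed
  have "istopology (\<lambda>U.
     U \<subseteq> complex_points V E C \<and>
     (\<forall>u v. {u, v} \<in> E \<longrightarrow>
        openin (top_of_set {0..1}) {t \<in> {0..1}. segment_pt u v t \<in> U}) \<and>
     (\<forall>c\<in>C. openin (top_of_set (cball 0 1)) {z \<in> cball 0 1. cell_map c z \<in> U}))"
    unfolding istopology_def
    by (intro conjI allI impI ballI N1 N2 U1 U2; blast)
  then show ?thesis
    unfolding two_complex_def by (simp add: topology_inverse')
qed

definition null_homotopic_loop :: "'a topology \<Rightarrow> (complex \<Rightarrow> 'a) \<Rightarrow> bool" where
  "null_homotopic_loop X f \<longleftrightarrow>
     (\<exists>p. homotopic_with (\<lambda>_. True) (top_of_set (sphere 0 1)) X f (\<lambda>_. p))"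

text \<open>Sanity checks: the characteristic maps land in the complex, and attached cycles do bound.\<close>

lemma walk_loop_in_complex_points:
  assumes "c \<noteq> []" and "\<And>i. {cyc_nth c i, cyc_nth c (i + 1)} \<in> E"
  shows "walk_loop c z \<in> complex_points V E C"
proof -
  define s where "s = real (length c) * Arg2pi z / (2 * pi)"
  have "frac s \<in> {0..1}"
    using frac_ge_0[of s] frac_lt_1[of s] by simp
  moreover have "walk_loop c z = segment_pt (cyc_nth c (nat \<lfloor>s\<rfloor>)) (cyc_nth c (nat \<lfloor>s\<rfloor> + 1)) (frac s)"
    by (simp add: walk_loop_def s_def Let_def)
  ultimately show ?thesis
    using assms(2)[of "nat \<lfloor>s\<rfloor>"] unfolding complex_points_def by blast
qed

lemma topspace_two_complex:
  assumes "\<And>c. c \<in> C \<Longrightarrow> graph_cycle E c"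
  shows "topspace (two_complex V E C) = complex_points V E C"
proof -
  have "{t \<in> {0..1}. segment_pt u v t \<in> complex_points V E C} = {0..1}" if "{u, v} \<in> E" for u v
    using that unfolding complex_points_def by blast
  moreover have "{z \<in> cball 0 1. cell_map c z \<in> complex_points V E C} = cball 0 1" if "c \<in> C" for c
  proof -
    have "walk_loop c z \<in> complex_points V E C" for z
      using assms[OF that] by (intro walk_loop_in_complex_points) (auto simp: graph_cycle_def)
    then show ?thesis
      using that by (auto simp: cell_map_def complex_points_def)
  qed
  ultimately have "openin (two_complex V E C) (complex_points V E C)"
    by (simp add: openin_two_complex)
  moreover have "topspace (two_complex V E C) \<subseteq> complex_points V E C"
    using openin_topspace[of "two_complex V E C"] unfolding openin_two_complex by blast
  ultimately show ?thesis
    using openin_subset by blast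
qed

lemma continuous_map_cell_map:
  assumes "\<And>c. c \<in> C \<Longrightarrow> graph_cycle E c" and "c \<in> C"
  shows "continuous_map (top_of_set (cball 0 1)) (two_complex V E C) (cell_map c)"
proof -
  have "cell_map c z \<in> complex_points V E C" if "z \<in> cball 0 1" for z
  proof -
    have "walk_loop c z \<in> complex_points V E C"
      using assms by (intro walk_loop_in_complex_points) (auto simp: graph_cycle_def)
    then show ?thesis
      using assms(2) by (auto simp: cell_map_def complex_points_def)
  qed
  then show ?thesis
    unfolding continuous_map_def
    using assms(2) by (auto simp: topspace_two_complex[OF assms(1)] openin_two_complex)
qed

lemma null_homotopic_attached_cycle:
  assumes "\<And>c. c \<in> C \<Longrightarrow> graph_cycle E c" and "c \<in> C"
  shows "null_homotopic_loop (two_complex V E C) (walk_loop c)"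
proof -
  have "homotopic_with (\<lambda>_. True) (top_of_set (sphere 0 1)) (top_of_set (cball (0::complex) 1))
          (\<lambda>z. z) (\<lambda>z. 0)"
  proof (rule homotopic_with_linear)
    show "closed_segment z 0 \<subseteq> cball 0 1" if "z \<in> sphere 0 1" for z :: complex
      using that by (intro closed_segment_subset) auto
  qed (auto intro: continuous_intros)
  then have "homotopic_with (\<lambda>_. True) (top_of_set (sphere 0 1)) (two_complex V E C)
               (cell_map c \<circ> (\<lambda>z. z)) (cell_map c \<circ> (\<lambda>z. 0))"
    by (rule homotopic_with_compose_continuous_map_left)
       (use continuous_map_cell_map[OF assms] in auto)
  then have "homotopic_with (\<lambda>_. True) (top_of_set (sphere 0 1)) (two_complex V E C)
               (walk_loop c) (\<lambda>_. cell_map c 0)"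
    by (rule homotopic_with_eq) (auto simp: cell_map_def)
  then show ?thesis
    unfolding null_homotopic_loop_def by blast
qed

definition paved_by_cycles :: "'v set \<Rightarrow> 'v set set \<Rightarrow> nat \<Rightarrow> 'v list \<Rightarrow> bool" where
  "paved_by_cycles V E L w \<longleftrightarrow>
     null_homotopic_loop (two_complex V E {c. graph_cycle E c \<and> length c \<le> L}) (walk_loop w)"

end

theory Submission
  imports Defs
begin

text \<open>Mutating a fork anywhere but at its point of return gives a fork again, so a reduced walk in the
  graph that once enters a fork through its point of return stays among forks and never comes back to
  the class of \<open>Q\<close>, which is not a fork. Every mutation of \<open>Q\<close> other than those at 1 and \<open>n\<close> enters such
  a fork, and so does every mutation leaving one of the two paths
  \<open>Q = T 0, \<dots>, T (2 * k)\<close> (mutations at 1, 2, 1, 2, \<dots>) and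
  \<open>Q = S 0, \<dots>, S (2 * k + 1) = R\<close> (mutations at \<open>n\<close>, 1, 2, 1, 2, \<dots>) before its end. A short cycle through \<open>Q\<close>
  would therefore follow both paths until they meet, but a comparison of sources and sinks shows that
  they do not meet within \<open>4 * k + 1\<close> steps.

  Hence no short cycle uses the edge from \<open>Q\<close> to \<open>S 1\<close>, and collapsing the rest of the complex maps it
  to a circle. The long mutation cycle does not visit the class of \<open>Q\<close> again, so it has degree one on
  that circle. This is where the hypothesis for \<open>n = 4\<close> enters: if \<open>b\<^sub>1\<^sub>4(Q) = b\<^sub>2\<^sub>3(R)\<close>, then mutating \<open>R\<close> at 3
  may lead back to the class of \<open>Q\<close>.\<close>

section \<open>Relabeling classes\<close>

text \<open>Where \<open>4 * k + 1\<close> comes from: mutations at 1 and 2 keep \<open>a\<close>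
  arrows between these vertices, and the entries at a third vertex run through a sequence x(m + 1) =
  a * x(m) - x(m - 1). Producing \<open>Q\<close> from \<open>Rt\<close> raises the index of such a
  sequence for each of 3, ..., n - 1; both paths from \<open>Q\<close> lower it again, one step per
  mutation at 1 or 2. While the index is positive, the triangles on 1, 2, j are oriented with
  weights ordered as in a fork, which makes the side mutations forks; at index 0 a sign changes.
  This gives the lengths \<open>2 * k\<close> and \<open>2 * k + 1\<close>. Vertex n follows a
  second, growing sequence, up to a shift the same on both paths. A cycle of length l following both
  paths identifies \<open>S s\<close> with \<open>T t\<close> for every split s + t = l within their
  lengths. Refuting one split is enough, and \<open>s = 1\<close> or \<open>s = 2 * k + 1\<close>
  covers all l: these two quivers have a source or a sink, and no \<open>T t\<close> with
  \<open>t > 0\<close> has one. That the long cycle, coming from \<open>R\<close>, meets the end of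
  the path \<open>T\<close> rests on a bilinear identity between the two sequences.\<close>

lemma quiver_on_skew: "quiver_on n B \<Longrightarrow> B i j = - B j i"
  unfolding quiver_on_def by blast

lemma quiver_on_outside: "quiver_on n B \<Longrightarrow> B i j \<noteq> 0 \<Longrightarrow> i \<in> {1..n} \<and> j \<in> {1..n}"
  unfolding quiver_on_def by blast

text \<open>The signed number of paths through the mutated vertex; it vanishes unless both arrows
  point the same way. This case form replaces the absolute values and \<open>div\<close> of
  \<open>mutate\<close>.\<close>

definition mut_term :: "int \<Rightarrow> int \<Rightarrow> int" where
  "mut_term x y = (if x > 0 \<and> y > 0 then x * y else if x < 0 \<and> y < 0 then - (x * y) else 0)"

lemma mut_term_eq: "(\<bar>x\<bar> * y + x * \<bar>y\<bar>) div 2 = mut_term x y"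
  by (auto simp: mut_term_def abs_if not_less algebra_simps)

lemma mutate_eq:
  "mutate k B i j = (if k = i \<or> k = j then - B i j else B i j + mut_term (B i k) (B k j))"
  by (simp add: mutate_def mut_term_eq)

lemma mut_term_minus: "mut_term (- x) (- y) = - mut_term x y"
  by (auto simp: mut_term_def)

lemma mut_term_commute: "mut_term x y = mut_term y x"
  by (auto simp: mut_term_def)

lemma mut_term_zero [simp]: "mut_term 0 y = 0" "mut_term x 0 = 0"
  by (auto simp: mut_term_def)

lemma mutate_skew:
  assumes "\<And>i j. B i j = - B j i"
  shows "mutate k B i j = - mutate k B j i"
proof -
  have "mut_term (B j k) (B k i) = - mut_term (B i k) (B k j)"
    using mut_term_minus[of "B k j" "B i k"] assms[of j k] assms[of k i] mut_term_commute by metis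
  then show ?thesis
    using assms[of i j] by (auto simp: mutate_eq)
qed

lemma quiver_on_mutate:
  assumes "quiver_on n B"
  shows "quiver_on n (mutate k B)"
  unfolding quiver_on_def
proof (intro conjI allI impI)
  show "mutate k B i j = - mutate k B j i" for i j
    using assms unfolding quiver_on_def by (intro mutate_skew) blast
  show "mutate k B i j = 0" if "i \<notin> {1..n} \<or> j \<notin> {1..n}" for i j
  proof -
    have "B i j = 0" "B i k = 0 \<or> B k j = 0"
      using that assms unfolding quiver_on_def by blast+
    then show ?thesis by (auto simp: mutate_eq)
  qed
qed

lemma mutate_mutate:
  assumes "quiver_on n B"
  shows "mutate k (mutate k B) = B"
proof (intro ext)
  fix i j
  show "mutate k (mutate k B) i j = B i j"
    using mut_term_minus[of "B i k" "B k j"] quiver_on_skew[OF assms, of k k]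
    by (auto simp: mutate_eq)
qed

lemma mutate_seq_Nil [simp]: "mutate_seq [] B = B"
  and mutate_seq_Cons [simp]: "mutate_seq (k # ks) B = mutate_seq ks (mutate k B)"
  and mutate_seq_append [simp]: "mutate_seq (ks @ ks') B = mutate_seq ks' (mutate_seq ks B)"
  by (simp_all add: mutate_seq_def)

lemma quiver_on_mutate_seq: "quiver_on n B \<Longrightarrow> quiver_on n (mutate_seq ks B)"
  by (induction ks arbitrary: B) (auto simp: quiver_on_mutate)

lemma mutate_seq_rev: "quiver_on n B \<Longrightarrow> mutate_seq (rev ks) (mutate_seq ks B) = B"
  by (induction ks arbitrary: B) (simp_all add: quiver_on_mutate mutate_mutate)

lemma mutate_relabel:
  assumes "bij \<sigma>" "\<epsilon> = 1 \<or> \<epsilon> = - 1"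
  shows "mutate k (\<lambda>i j. \<epsilon> * P (\<sigma> i) (\<sigma> j)) = (\<lambda>i j. \<epsilon> * mutate (\<sigma> k) P (\<sigma> i) (\<sigma> j))"
  using assms mut_term_minus by (auto simp: mutate_eq fun_eq_iff bij_def inj_eq)

text \<open>Normal form of the equivalence closure: reversal is an involution commuting with
  relabelings, so any chain of generating steps collapses to one permutation and one sign.\<close>

definition similar_quivers :: "nat \<Rightarrow> quiver \<Rightarrow> quiver \<Rightarrow> bool" where
  "similar_quivers n P P' \<longleftrightarrow>
     (\<exists>\<sigma> \<epsilon>. \<sigma> permutes {1..n} \<and> (\<epsilon> = 1 \<or> \<epsilon> = - 1) \<and> P' = (\<lambda>i j. \<epsilon> * P (\<sigma> i) (\<sigma> j)))"

lemma similar_quivers_refl: "similar_quivers n P P"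
  unfolding similar_quivers_def by (rule exI[of _ id], rule exI[of _ 1]) (auto simp: permutes_id)

lemma similar_quivers_sym:
  assumes "similar_quivers n P P'"
  shows "similar_quivers n P' P"
proof -
  obtain \<sigma> \<epsilon> where *: "\<sigma> permutes {1..n}" "\<epsilon> = 1 \<or> \<epsilon> = - 1" "P' = (\<lambda>i j. \<epsilon> * P (\<sigma> i) (\<sigma> j))"
    using assms unfolding similar_quivers_def by blast
  have "P = (\<lambda>i j. \<epsilon> * P' (inv \<sigma> i) (inv \<sigma> j))"
    using * by (auto simp: permutes_inverses fun_eq_iff)
  then show ?thesis
    using *(2) permutes_inv[OF *(1)] unfolding similar_quivers_def by blast
qed

lemma similar_quivers_trans:
  assumes "similar_quivers n P P'" "similar_quivers n P' P''"
  shows "similar_quivers n P P''"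
proof -
  obtain \<sigma> \<epsilon> where *: "\<sigma> permutes {1..n}" "\<epsilon> = 1 \<or> \<epsilon> = - 1" "P' = (\<lambda>i j. \<epsilon> * P (\<sigma> i) (\<sigma> j))"
    using assms(1) unfolding similar_quivers_def by blast
  obtain \<tau> \<delta> where **: "\<tau> permutes {1..n}" "\<delta> = 1 \<or> \<delta> = - 1" "P'' = (\<lambda>i j. \<delta> * P' (\<tau> i) (\<tau> j))"
    using assms(2) unfolding similar_quivers_def by blast
  have "P'' = (\<lambda>i j. (\<delta> * \<epsilon>) * P ((\<sigma> \<circ> \<tau>) i) ((\<sigma> \<circ> \<tau>) j))"
    using *(3) **(3) by (auto simp: fun_eq_iff)
  moreover have "\<delta> * \<epsilon> = 1 \<or> \<delta> * \<epsilon> = - 1"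
    using *(2) **(2) by auto
  ultimately show ?thesis
    using permutes_compose[OF **(1) *(1)] unfolding similar_quivers_def by blast
qed

lemma equivclp_relabel_or_reverse: "equivclp (relabel_or_reverse n) P P' \<longleftrightarrow> similar_quivers n P P'"
proof
  assume "equivclp (relabel_or_reverse n) P P'"
  then show "similar_quivers n P P'"
  proof (induction rule: equivclp_induct)
    case base
    show ?case by (rule similar_quivers_refl)
  next
    case (step y z)
    have rr: "similar_quivers n x y" if "relabel_or_reverse n x y" for x y
      using that unfolding relabel_or_reverse_def
    proof
      assume "\<exists>\<sigma>. \<sigma> permutes {1..n} \<and> y = (\<lambda>i j. x (\<sigma> i) (\<sigma> j))"
      then show ?thesis
        unfolding similar_quivers_def by (metis mult_1)
    next
      assume "y = (\<lambda>i j. - x i j)"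
      then show ?thesis
        unfolding similar_quivers_def
        by (intro exI[of _ id] exI[of _ "-1"]) (auto simp: permutes_id)
    qed
    have "similar_quivers n y z"
      using step.hyps(2) rr similar_quivers_sym by metis
    with step.IH show ?case
      by (rule similar_quivers_trans)
  qed
next
  assume "similar_quivers n P P'"
  then obtain \<sigma> \<epsilon> where *: "\<sigma> permutes {1..n}" "\<epsilon> = 1 \<or> \<epsilon> = - 1" "P' = (\<lambda>i j. \<epsilon> * P (\<sigma> i) (\<sigma> j))"
    unfolding similar_quivers_def by blast
  define P1 where "P1 = (\<lambda>i j. P (\<sigma> i) (\<sigma> j))"
  have 1: "relabel_or_reverse n P P1"
    using *(1) unfolding relabel_or_reverse_def P1_def by blast
  have "P' = P1 \<or> relabel_or_reverse n P1 P'"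
    using *(2,3) unfolding relabel_or_reverse_def P1_def by auto
  then show "equivclp (relabel_or_reverse n) P P'"
    using 1 by (metis equivclp_into_equivclp r_into_equivclp)
qed

lemma mem_quiver_class: "P' \<in> quiver_class n P \<longleftrightarrow> similar_quivers n P P'"
  by (simp add: quiver_class_def equivclp_relabel_or_reverse)

lemma quiver_class_eq_iff: "quiver_class n P = quiver_class n P' \<longleftrightarrow> similar_quivers n P P'"
proof
  assume "quiver_class n P = quiver_class n P'"
  moreover have "P' \<in> quiver_class n P'"
    by (simp add: mem_quiver_class similar_quivers_refl)
  ultimately show "similar_quivers n P P'"
    by (simp add: mem_quiver_class[symmetric])
next
  assume PP': "similar_quivers n P P'"
  show "quiver_class n P = quiver_class n P'"
  proof (intro set_eqI iffI)
    fix R assume "R \<in> quiver_class n P"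
    then show "R \<in> quiver_class n P'"
      unfolding mem_quiver_class
      by (rule similar_quivers_trans[OF similar_quivers_sym[OF PP']])
  next
    fix R assume "R \<in> quiver_class n P'"
    then show "R \<in> quiver_class n P"
      unfolding mem_quiver_class by (rule similar_quivers_trans[OF PP'])
  qed
qed

lemma quiver_on_similar:
  assumes "similar_quivers n P P'" "quiver_on n P"
  shows "quiver_on n P'"
proof -
  obtain \<sigma> \<epsilon> where *: "\<sigma> permutes {1..n}" "\<epsilon> = 1 \<or> \<epsilon> = - 1" "P' = (\<lambda>i j. \<epsilon> * P (\<sigma> i) (\<sigma> j))"
    using assms(1) unfolding similar_quivers_def by blast
  have "P' i j = 0" if "i \<notin> {1..n} \<or> j \<notin> {1..n}" for i j
    using that quiver_on_outside[OF assms(2), of "\<sigma> i" "\<sigma> j"]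
    unfolding *(3) permutes_in_image[OF *(1)] by auto
  moreover have "P' i j = - P' j i" for i j
    using quiver_on_skew[OF assms(2), of "\<sigma> i" "\<sigma> j"] by (simp add: *(3))
  ultimately show ?thesis
    unfolding quiver_on_def by blast
qed

lemma similar_quivers_mutate:
  assumes "similar_quivers n P P'" "k \<in> {1..n}"
  shows "\<exists>l\<in>{1..n}. similar_quivers n (mutate l P) (mutate k P')"
proof -
  obtain \<sigma> \<epsilon> where *: "\<sigma> permutes {1..n}" "\<epsilon> = 1 \<or> \<epsilon> = - 1" "P' = (\<lambda>i j. \<epsilon> * P (\<sigma> i) (\<sigma> j))"
    using assms(1) unfolding similar_quivers_def by blast
  have "mutate k P' = (\<lambda>i j. \<epsilon> * mutate (\<sigma> k) P (\<sigma> i) (\<sigma> j))"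
    unfolding *(3) using permutes_bij[OF *(1)] *(2) by (rule mutate_relabel)
  then have "similar_quivers n (mutate (\<sigma> k) P) (mutate k P')"
    using * unfolding similar_quivers_def by blast
  then show ?thesis
    using permutes_in_image[OF *(1)] assms(2) by blast
qed

lemma Gamma_edges_irrefl: "{u, v} \<in> Gamma_edges n Q \<Longrightarrow> u \<noteq> v"
  unfolding Gamma_edges_def by (auto simp: doubleton_eq_iff)

text \<open>An edge is unordered and witnessed by arbitrary representatives. Similarity carries the
  witness over to the given \<open>S\<close>; if it points towards the class of \<open>S\<close>,
  involutivity of mutation turns it around.\<close>

lemma Gamma_edge_mutate:
  assumes "quiver_on n Q" "quiver_on n S" "{quiver_class n S, Y} \<in> Gamma_edges n Q"
  shows "\<exists>j\<in>{1..n}. Y = quiver_class n (mutate j S)"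
proof -
  have verts: "\<exists>P. quiver_on n P \<and> X = quiver_class n P" if "X \<in> Gamma_verts n Q" for X
    using that quiver_on_mutate_seq[OF assms(1)] unfolding Gamma_verts_def mutation_class_def by blast
  obtain X Z P k where XZ: "{quiver_class n S, Y} = {X, Z}" "X \<in> Gamma_verts n Q" "Z \<in> Gamma_verts n Q"
    "P \<in> X" "k \<in> {1..n}" "mutate k P \<in> Z"
    using assms(3) unfolding Gamma_edges_def by blast
  have rep: "quiver_on n P' \<and> X' = quiver_class n P'" if "X' \<in> Gamma_verts n Q" "P' \<in> X'" for X' P'
    using verts[OF that(1)] that(2) quiver_on_similar
    by (metis mem_quiver_class quiver_class_eq_iff)
  consider "X = quiver_class n S" "Z = Y" | "X = Y" "Z = quiver_class n S"
    using XZ(1) by (auto simp: doubleton_eq_iff)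
  then show ?thesis
  proof cases
    case 1
    then obtain l where l: "l \<in> {1..n}" "similar_quivers n (mutate l S) (mutate k P)"
      using XZ similar_quivers_mutate by (metis mem_quiver_class)
    have "Y = quiver_class n (mutate k P)"
      using rep[OF XZ(3,6)] 1 by simp
    then show ?thesis
      using l quiver_class_eq_iff by metis
  next
    case 2
    have P: "quiver_on n P" "Y = quiver_class n P"
      using rep[OF XZ(2,4)] 2 by auto
    have "similar_quivers n S (mutate k P)"
      using XZ(6) 2 by (simp add: mem_quiver_class)
    then obtain l where l: "l \<in> {1..n}" "similar_quivers n (mutate l S) (mutate k (mutate k P))"
      using XZ(5) similar_quivers_mutate by blast
    then show ?thesis
      using P mutate_mutate[OF P(1)] quiver_class_eq_iff by metis
  qed
qed

section \<open>An edge detected by a circle-valued map\<close>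

lemma walk_loop_cis:
  assumes "0 \<le> \<theta>" "\<theta> < 2 * pi"
  shows "walk_loop w (cis \<theta>) =
    (let s = real (length w) * \<theta> / (2 * pi); i = nat \<lfloor>s\<rfloor>
     in segment_pt (cyc_nth w i) (cyc_nth w (i + 1)) (frac s))"
proof -
  have "Arg2pi (cis \<theta>) = \<theta>"
    using assms by (intro Arg2pi_unique[where r = 1]) (auto simp: cis_conv_exp)
  then show ?thesis by (simp add: walk_loop_def)
qed

text \<open>\<open>f\<close> turns once around the circle during the first of \<open>L\<close> equal
  time steps and then rests at 1. A null-homotopic \<open>f\<close> has a continuous real logarithm
  \<open>g\<close> on the circle; \<open>g\<close> minus the angle is an integer multiple of 2 pi,
  hence constant, although one turn changes the angle by 2 pi and restores \<open>g\<close>.\<close>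

lemma circle_map_degree_one_essential:
  fixes f :: "complex \<Rightarrow> complex" and L :: real
  assumes L: "L \<ge> 1"
    and f: "\<And>\<theta>. 0 \<le> \<theta> \<Longrightarrow> \<theta> < 2 * pi \<Longrightarrow> f (cis \<theta>) = cis (min (L * \<theta>) (2 * pi))"
  shows "\<not> null_homotopic_loop (top_of_set (sphere 0 1)) f"
proof
  assume "null_homotopic_loop (top_of_set (sphere 0 1)) f"
  then obtain a where "homotopic_with (\<lambda>_. True) (top_of_set (sphere 0 1)) (top_of_set (sphere 0 1)) f (\<lambda>_. a)"
    unfolding null_homotopic_loop_def by blast
  then obtain g where g: "continuous_on (sphere 0 1) g" "\<And>z. z \<in> sphere 0 1 \<Longrightarrow> f z = exp (\<i> * complex_of_real (g z))"
    using inessential_eq_continuous_logarithm_circle[of "sphere 0 1" f] by blast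
  define h where "h = (\<lambda>\<theta>. (g (cis \<theta>) - min (L * \<theta>) (2 * pi)) / (2 * pi))"
  have "continuous_on {0..2*pi} (\<lambda>\<theta>. g (cis \<theta>))"
    by (rule continuous_on_compose2[OF g(1)]) (auto intro!: continuous_intros)
  then have cont: "continuous_on {0..2*pi} h"
    unfolding h_def by (intro continuous_intros) auto
  have int: "h \<theta> \<in> \<int>" if "\<theta> \<in> {0..2*pi}" for \<theta>
  proof -
    have "f (cis \<theta>) = cis (min (L * \<theta>) (2 * pi))"
    proof (cases "\<theta> = 2 * pi")
      case True
      have "1 * (2 * pi) \<le> L * (2 * pi)"
        using L by (intro mult_right_mono) auto
      then show ?thesis
        using True f[of 0] by (simp add: min_def)
    next
      case False
      then show ?thesis using f that by auto
    qed
    then have "cis (g (cis \<theta>)) = cis (min (L * \<theta>) (2 * pi))"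
      using g(2)[of "cis \<theta>"] by (simp add: cis_conv_exp)
    then have "cis (g (cis \<theta>) - min (L * \<theta>) (2 * pi)) = 1"
      by (simp add: cis_divide[symmetric])
    then have "cos (g (cis \<theta>) - min (L * \<theta>) (2 * pi)) = 1"
      by (metis cis.simps(1) one_complex.simps(1))
    then obtain m :: int where "g (cis \<theta>) - min (L * \<theta>) (2 * pi) = of_int m * 2 * pi"
      using cos_one_2pi_int by blast
    then have "h \<theta> = of_int m"
      unfolding h_def by simp
    then show ?thesis by simp
  qed
  have "h constant_on {0..2*pi}"
  proof (rule continuous_discrete_range_constant[OF _ cont])
    show "\<exists>e>0. \<forall>y. y \<in> {0..2*pi} \<and> h y \<noteq> h x \<longrightarrow> e \<le> norm (h y - h x)" if "x \<in> {0..2*pi}" for x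
    proof (intro exI[of _ 1] conjI allI impI)
      fix y assume y: "y \<in> {0..2*pi} \<and> h y \<noteq> h x"
      have "h y - h x \<in> \<int>" using int that y by (intro Ints_diff) auto
      then show "1 \<le> norm (h y - h x)"
        using Ints_nonzero_abs_ge1[of "h y - h x"] y by auto
    qed simp
  qed simp
  then have "h 0 = h (2 * pi)"
    unfolding constant_on_def by auto
  moreover have "2 * pi \<le> L * (2 * pi)"
    using L mult_right_mono[of 1 L "2 * pi"] by simp
  ultimately show False
    by (simp add: h_def min_def split: if_splits)
qed

text \<open>Collapsing everything but the interior of the edge from \<open>A\<close> to the next vertex yields a map
  onto the circle: no attached disk meets that edge, and the walk traverses it exactly once.\<close>

lemma not_paved_by_cycles:
  fixes E :: "'v set set"
  assumes irrefl: "\<And>u v. {u, v} \<in> E \<Longrightarrow> u \<noteq> v"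
    and C: "\<And>c. graph_cycle E c \<Longrightarrow> length c \<le> L \<Longrightarrow> A \<notin> set c"
    and vs: "A \<notin> set vs" "vs \<noteq> []" "last vs \<noteq> hd vs"
  shows "\<not> paved_by_cycles V E L (A # vs)"
proof
  define C where "C = {c. graph_cycle E c \<and> length c \<le> L}"
  define X where "X = two_complex V E C"
  define B where "B = hd vs"
  \<comment> \<open>The coordinates at \<open>A\<close> and \<open>B\<close> are both nonzero only
    inside the edge between them. If only the one at \<open>A\<close> is nonzero the angle is 0, and
    the test on \<open>p A\<close> sends the other edges at \<open>B\<close> to 1.\<close>
  define f where "f = (\<lambda>x :: 'v complex_pt. case x of
      Graph_pt p \<Rightarrow> if p A \<noteq> 0 then cis (2 * pi * p B) else 1 | Disk_pt _ _ \<Rightarrow> 1)"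
  have AB: "A \<noteq> B" using vs unfolding B_def by (metis hd_in_set)
  have f_other: "f (segment_pt u v t) = 1" if "A \<notin> {u, v} \<or> B \<notin> {u, v}" for u v t
    using that by (auto simp: f_def segment_pt_def)
  have f_AB: "f (segment_pt A B t) = cis (2 * pi * t)" for t
    using AB by (auto simp: f_def segment_pt_def)
  have f_BA: "f (segment_pt B A t) = cis (2 * pi * (1 - t))" for t
    using AB by (auto simp: f_def segment_pt_def)
  have edge_cont: "continuous_on {0..1} (\<lambda>t. f (segment_pt u v t))" if "{u, v} \<in> E" for u v
  proof -
    have "u \<noteq> v" using irrefl that by blast
    then consider "A \<notin> {u, v} \<or> B \<notin> {u, v}" | "u = A" "v = B" | "u = B" "v = A"
      using AB by auto
    then show ?thesis
      by cases (auto simp: f_other f_AB f_BA intro!: continuous_intros)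
  qed
  have cell: "f (cell_map c z) = 1" if "c \<in> C" for c z
  proof (cases "norm z < 1")
    case True
    then show ?thesis by (simp add: cell_map_def f_def)
  next
    case False
    have "A \<notin> set c" "c \<noteq> []" using that C by (auto simp: C_def graph_cycle_def)
    then have "A \<noteq> cyc_nth c i" for i
      unfolding cyc_nth_def by (metis length_greater_0_conv mod_less_divisor nth_mem)
    then show ?thesis
      using False by (simp add: cell_map_def walk_loop_def Let_def f_other)
  qed
  have f_sphere: "f x \<in> sphere 0 1" for x
    by (auto simp: f_def split: complex_pt.splits)
  have top: "topspace X = complex_points V E C"
    unfolding X_def by (rule topspace_two_complex) (simp add: C_def)
  have cont: "continuous_map X (top_of_set (sphere 0 1)) f"
    unfolding continuous_map_def
  proof (intro conjI allI impI)
    show "f \<in> topspace X \<rightarrow> topspace (top_of_set (sphere 0 1))"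
      using f_sphere by auto
    fix U assume "openin (top_of_set (sphere (0::complex) 1)) U"
    then obtain W where W: "open W" "U = sphere 0 1 \<inter> W"
      by (auto simp: openin_open)
    have U: "f x \<in> U \<longleftrightarrow> f x \<in> W" for x
      using f_sphere W by blast
    have "openin (top_of_set {0..1}) {t \<in> {0..1}. segment_pt u v t \<in> {x \<in> complex_points V E C. f x \<in> U}}"
      if "{u, v} \<in> E" for u v
    proof -
      have "{t \<in> {0..1}. segment_pt u v t \<in> {x \<in> complex_points V E C. f x \<in> U}} =
         {0..1} \<inter> (\<lambda>t. f (segment_pt u v t)) -` W"
      proof -
        have "segment_pt u v t \<in> complex_points V E C" if "t \<in> {0..1}" for t
          using that \<open>{u, v} \<in> E\<close> unfolding complex_points_def by blast
        then show ?thesis by (auto simp: U)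
      qed
      then show ?thesis
        using continuous_openin_preimage_gen[OF edge_cont[OF that] W(1)] by simp
    qed
    moreover have "openin (top_of_set (cball 0 1)) {z \<in> cball 0 1. cell_map c z \<in> {x \<in> complex_points V E C. f x \<in> U}}"
      if "c \<in> C" for c
    proof -
      have "continuous_map (top_of_set (cball 0 1)) X (cell_map c)"
        unfolding X_def by (rule continuous_map_cell_map) (use that in \<open>auto simp: C_def\<close>)
      then have "cell_map c z \<in> complex_points V E C" if "z \<in> cball 0 1" for z
        using that top by (auto simp: continuous_map_def)
      then have "{z \<in> cball 0 1. cell_map c z \<in> {x \<in> complex_points V E C. f x \<in> U}} =
          (if 1 \<in> U then cball 0 1 else {})"
        using cell[OF that] by auto
      then show ?thesis by simp
    qed
    ultimately show "openin X {x \<in> topspace X. f x \<in> U}"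
      unfolding X_def top[unfolded X_def] by (auto simp: openin_two_complex)
  qed
  assume "paved_by_cycles V E L (A # vs)"
  then obtain p where p: "homotopic_with (\<lambda>_. True) (top_of_set (sphere 0 1)) X (walk_loop (A # vs)) (\<lambda>_. p)"
    unfolding paved_by_cycles_def null_homotopic_loop_def X_def C_def by blast
  have "homotopic_with (\<lambda>_. True) (top_of_set (sphere 0 1)) (top_of_set (sphere 0 1))
     (f \<circ> walk_loop (A # vs)) (f \<circ> (\<lambda>_. p))"
    by (rule homotopic_with_compose_continuous_map_left[OF p cont]) auto
  then have nh: "null_homotopic_loop (top_of_set (sphere 0 1)) (f \<circ> walk_loop (A # vs))"
    unfolding null_homotopic_loop_def comp_def by blast
  define l where "l = length (A # vs)"
  have l: "l \<ge> 2" using vs by (cases vs) (auto simp: l_def)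
  have "(f \<circ> walk_loop (A # vs)) (cis \<theta>) = cis (min (real l * \<theta>) (2 * pi))"
    if \<theta>: "0 \<le> \<theta>" "\<theta> < 2 * pi" for \<theta>
  proof -
    define s where "s = real l * \<theta> / (2 * pi)"
    define i where "i = nat \<lfloor>s\<rfloor>"
    have s0: "s \<ge> 0" using \<theta> by (simp add: s_def)
    have sl: "s < l" using \<theta> l by (simp add: s_def field_simps)
    have i: "i < l" using s0 sl by (simp add: i_def floor_less_iff nat_less_iff)
    have eq: "(f \<circ> walk_loop (A # vs)) (cis \<theta>) =
       f (segment_pt (cyc_nth (A # vs) i) (cyc_nth (A # vs) (i + 1)) (frac s))"
      using \<theta> by (simp add: walk_loop_cis Let_def s_def i_def l_def)
    show ?thesis
    proof (cases "i = 0")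
      case True
      then have "s < 1" using s0 by (simp add: i_def floor_le_iff nat_eq_iff2)
      then have "frac s = s" using s0 by (simp add: frac_eq)
      moreover have "cyc_nth (A # vs) (i + 1) = B" "cyc_nth (A # vs) i = A"
        using True vs(2) by (auto simp: cyc_nth_def B_def hd_conv_nth)
      moreover have "real l * \<theta> \<le> 2 * pi" "2 * pi * s = real l * \<theta>"
        using \<open>s < 1\<close> by (auto simp: s_def field_simps)
      ultimately show ?thesis
        unfolding eq by (simp add: f_AB min_def)
    next
      case False
      then have "1 \<le> s" using s0 by (simp add: i_def)
      then have "2 * pi \<le> real l * \<theta>" by (simp add: s_def field_simps)
      then have rhs: "cis (min (real l * \<theta>) (2 * pi)) = 1" by simp
      have ci: "cyc_nth (A # vs) i = vs ! (i - 1)" "i - 1 < length vs"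
        using False i by (auto simp: cyc_nth_def l_def)
      then have cA: "cyc_nth (A # vs) i \<noteq> A"
        using vs(1) nth_mem by metis
      show ?thesis
      proof (cases "i + 1 = l")
        \<comment> \<open>The closing step returns to \<open>A\<close> from \<open>last vs\<close>,
          which differs from \<open>B\<close>; otherwise it would run back over the edge and cancel
          the degree.\<close>
        case True
        have "cyc_nth (A # vs) i = last vs"
          using ci True vs(2) by (simp add: last_conv_nth l_def)
        moreover have "cyc_nth (A # vs) (i + 1) = A"
          using True by (simp add: cyc_nth_def l_def)
        ultimately show ?thesis
          unfolding eq rhs using vs(3) AB B_def by (intro f_other) auto
      next
        case False
        then have "cyc_nth (A # vs) (i + 1) = vs ! i" "i < length vs"
          using i by (auto simp: cyc_nth_def l_def)
        then have "cyc_nth (A # vs) (i + 1) \<noteq> A"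
          using vs(1) nth_mem by metis
        then show ?thesis
          unfolding eq rhs using cA by (intro f_other) auto
      qed
    qed
  qed
  then have "\<not> null_homotopic_loop (top_of_set (sphere 0 1)) (f \<circ> walk_loop (A # vs))"
    using l by (intro circle_map_degree_one_essential[where L = "real l"]) auto
  with nh show False by contradiction
qed

section \<open>Forks and reduced closed walks\<close>

definition abundant :: "nat \<Rightarrow> quiver \<Rightarrow> bool" where
  "abundant n F \<longleftrightarrow> quiver_on n F \<and> (\<forall>i\<in>{1..n}. \<forall>j\<in>{1..n}. i \<noteq> j \<longrightarrow> \<bar>F i j\<bar> \<ge> 2)"

definition triangle :: "quiver \<Rightarrow> nat \<Rightarrow> nat \<Rightarrow> nat \<Rightarrow> bool" where
  "triangle F i j l \<longleftrightarrow> F i j > 0 \<and> F j l > 0 \<and> F l i > 0"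

text \<open>Warkentin's forks with point of return \<open>r\<close>, except that \<open>r\<close> may also be a source or a sink.
  In an abundant quiver, having no oriented triangle is the same as being acyclic.\<close>

definition weak_fork :: "nat \<Rightarrow> nat \<Rightarrow> quiver \<Rightarrow> bool" where
  "weak_fork n r F \<longleftrightarrow> abundant n F \<and>
     (\<forall>i l. F i r > 0 \<and> F r l > 0 \<longrightarrow> F l i > F i r \<and> F l i > F r l) \<and>
     (\<forall>i j l. i \<noteq> r \<and> j \<noteq> r \<and> l \<noteq> r \<longrightarrow> \<not> triangle F i j l)"

lemma abundant_cases:
  assumes "abundant n F" "i \<in> {1..n}" "j \<in> {1..n}" "i \<noteq> j"
  obtains "F i j \<ge> 2" | "F j i \<ge> 2"
proof -
  have "\<bar>F i j\<bar> \<ge> 2" "F i j = - F j i"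
    using assms quiver_on_skew unfolding abundant_def by blast+
  then show thesis using that by linarith
qed

lemma abundant_pos:
  assumes "abundant n F" "F i j > 0"
  shows "F i j \<ge> 2" "i \<in> {1..n}" "j \<in> {1..n}" "i \<noteq> j" "F j i < 0"
proof -
  have F: "quiver_on n F" using assms by (simp add: abundant_def)
  show r: "i \<in> {1..n}" "j \<in> {1..n}"
    using quiver_on_outside[OF F, of i j] assms(2) by auto
  show ne: "i \<noteq> j" and "F j i < 0"
    using quiver_on_skew[OF F, of i j] assms(2) by auto
  show "F i j \<ge> 2"
    using abundant_cases[OF assms(1) r ne] \<open>F j i < 0\<close> by auto
qed

lemma mult_ge_twice:
  fixes x y :: int
  assumes "x \<ge> 2" "y \<ge> 2"
  shows "x * y \<ge> 2 * x" "x * y \<ge> 2 * y"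
  using mult_left_mono[of 2 y x] mult_right_mono[of 2 x y] assms by auto

text \<open>Only entries between an in-neighbour i and an out-neighbour l of \<open>j\<close>
  change, and by abundance and \<open>tri\<close> they all become arrows i -> l heavier than both
  arrows at \<open>j\<close>. An oriented triangle of the new quiver avoiding \<open>j\<close> would
  thus stay on one side of \<open>j\<close>, where nothing changed.\<close>

lemma weak_fork_mutateI:
  assumes S: "abundant n S" and j: "j \<in> {1..n}"
    and tri: "\<And>i l. triangle S i j l \<Longrightarrow> S i j * S j l - S l i > S i j \<and> S i j * S j l - S l i > S j l"
    and ins: "\<And>x y z. S x j > 0 \<Longrightarrow> S y j > 0 \<Longrightarrow> S z j > 0 \<Longrightarrow> \<not> triangle S x y z"
    and outs: "\<And>x y z. S j x > 0 \<Longrightarrow> S j y > 0 \<Longrightarrow> S j z > 0 \<Longrightarrow> \<not> triangle S x y z"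
  shows "weak_fork n j (mutate j S)"
proof -
  have q: "quiver_on n S" using S by (simp add: abundant_def)
  note skew = quiver_on_skew[OF q]
  define S' where "S' = mutate j S"
  have q': "quiver_on n S'" unfolding S'_def by (rule quiver_on_mutate[OF q])
  have S'j: "S' i j = S j i" "S' j i = S i j" for i
    using skew[of i j] skew[of j i] by (auto simp: S'_def mutate_eq)
  have through: "S' i l > S i j \<and> S' i l > S j l" if "S i j > 0" "S j l > 0" for i l
  proof -
    have il: "i \<in> {1..n}" "l \<in> {1..n}" "i \<noteq> l" "i \<noteq> j" "l \<noteq> j" "S i j \<ge> 2" "S j l \<ge> 2"
      using abundant_pos[OF S that(1)] abundant_pos[OF S that(2)] that by auto
    have eq: "S' i l = S i l + S i j * S j l"
      using il that by (auto simp: S'_def mutate_eq mut_term_def)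
    show ?thesis
    proof (cases rule: abundant_cases[OF S il(1,2,3)])
      case 1
      then show ?thesis using mult_ge_twice[OF il(6,7)] that eq by linarith
    next
      case 2
      then show ?thesis using tri[of i l] that eq skew[of i l] by (simp add: triangle_def)
    qed
  qed
  have unchanged: "S' x y = S x y" if "S x j > 0 \<and> S y j > 0 \<or> S j x > 0 \<and> S j y > 0" for x y
    using that skew[of x j] skew[of y j] skew[of j j] by (auto simp: S'_def mutate_eq mut_term_def)
  have side: "S x j > 0 \<or> S j x > 0" if "x \<in> {1..n}" "x \<noteq> j" for x
    using abundant_cases[OF S that(1) j that(2)] by force
  have "abundant n S'"
    unfolding abundant_def
  proof (intro conjI ballI impI q')
    fix x y assume xy: "x \<in> {1..n}" "y \<in> {1..n}" "x \<noteq> y"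
    have S2: "\<bar>S x y\<bar> \<ge> 2" using S xy by (simp add: abundant_def)
    show "\<bar>S' x y\<bar> \<ge> 2"
    proof (cases "x = j \<or> y = j")
      case True
      then show ?thesis using S2 S'j skew[of x y] by auto
    next
      case False
      then consider "S x j > 0 \<and> S y j > 0 \<or> S j x > 0 \<and> S j y > 0" | "S x j > 0" "S j y > 0" | "S y j > 0" "S j x > 0"
        using side xy by blast
      then show ?thesis
      proof cases
        case 1
        then show ?thesis using unchanged S2 by simp
      next
        case 2
        then show ?thesis using through[of x y] abundant_pos(1)[OF S 2(1)] by linarith
      next
        case 3
        then show ?thesis
          using through[of y x] abundant_pos(1)[OF S 3(1)] quiver_on_skew[OF q', of x y] by linarith
      qed
    qed
  qed
  moreover have "S' l i > S' i j \<and> S' l i > S' j l" if "S' i j > 0" "S' j l > 0" for i l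
    using that through[of l i] by (simp add: S'j)
  moreover have "\<not> triangle S' x y z" if "x \<noteq> j" "y \<noteq> j" "z \<noteq> j" for x y z
  proof
    assume t: "triangle S' x y z"
    have "x \<in> {1..n}" "y \<in> {1..n}" "z \<in> {1..n}"
      using t quiver_on_outside[OF q'] unfolding triangle_def by (metis less_irrefl)+
    then have s: "S x j > 0 \<or> S j x > 0" "S y j > 0 \<or> S j y > 0" "S z j > 0 \<or> S j z > 0"
      using side that by blast+
    have mono: "\<not> (S j x > 0 \<and> S y j > 0)" if "S' x y > 0" for x y
      using through[of y x] that quiver_on_skew[OF q', of x y] by force
    consider "S x j > 0" "S y j > 0" "S z j > 0" | "S j x > 0" "S j y > 0" "S j z > 0"
      using s mono[of x y] mono[of y z] mono[of z x] t unfolding triangle_def by blast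
    then show False
    proof cases
      case 1
      then show False using ins[OF 1] t by (simp add: triangle_def unchanged)
    next
      case 2
      then show False using outs[OF 2] t by (simp add: triangle_def unchanged)
    qed
  qed
  ultimately show ?thesis
    unfolding weak_fork_def S'_def by blast
qed

lemma triangle_rotate: "triangle F i j l \<Longrightarrow> triangle F j l i"
  by (simp add: triangle_def)

text \<open>An oriented triangle through \<open>j\<close> also contains \<open>r\<close>, and the
  arrow opposite \<open>r\<close>, which ends at \<open>j\<close>, outweighs the other two; its
  product with a weight of at least 2 survives the subtraction. A triangle among the in- or
  out-neighbours of \<open>j\<close> would contain \<open>r\<close> too and give a path through
  \<open>r\<close> with an end at \<open>j\<close> whose ends are joined the wrong way for a
  fork.\<close>

lemma weak_fork_mutate:
  assumes F: "weak_fork n r F" and j: "j \<in> {1..n}" "j \<noteq> r"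
  shows "weak_fork n j (mutate j F)"
proof (rule weak_fork_mutateI[OF _ j(1)])
  show ab: "abundant n F" using F by (simp add: weak_fork_def)
  have pr: "F l i > F i r" "F l i > F r l" if "F i r > 0" "F r l > 0" for i l
    using F that unfolding weak_fork_def by blast+
  have nt: "x = r \<or> y = r \<or> z = r" if "triangle F x y z" for x y z
    using F that unfolding weak_fork_def by blast
  fix i l assume t: "triangle F i j l"
  then have p: "F i j > 0" "F j l > 0" "F l i > 0" by (auto simp: triangle_def)
  have m: "F i j * F j l \<ge> 2 * F i j" "F i j * F j l \<ge> 2 * F j l"
    using mult_ge_twice abundant_pos(1)[OF ab] p by blast+
  consider "i = r" | "l = r" using nt[OF t] j by blast
  then show "F i j * F j l - F l i > F i j \<and> F i j * F j l - F l i > F j l"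
  proof cases
    case 1
    then have "F j l > F l i" "F j l > F i j" using pr[of l j] p by auto
    then show ?thesis using m by linarith
  next
    case 2
    then have "F i j > F j l" "F i j > F l i" using pr[of j i] p by auto
    then show ?thesis using m by linarith
  qed
next
  have ab: "abundant n F" using F by (simp add: weak_fork_def)
  have pr: "F l i > 0" if "F i r > 0" "F r l > 0" for i l
    using F that unfolding weak_fork_def by force
  have nt: "x = r \<or> y = r \<or> z = r" if "triangle F x y z" for x y z
    using F that unfolding weak_fork_def by blast
  have neg: "F y x < 0" if "F x y > 0" for x y
    using abundant_pos[OF ab that] by blast
  show "\<not> triangle F x y z" if "F x j > 0" "F y j > 0" "F z j > 0" for x y z
  proof
    assume t: "triangle F x y z"
    have "\<exists>a. F a r > 0 \<and> F a j > 0 \<and> F r j > 0"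
      using nt[OF t] t that unfolding triangle_def by blast
    then show False using pr neg by (metis less_asym)
  qed
  show "\<not> triangle F x y z" if "F j x > 0" "F j y > 0" "F j z > 0" for x y z
  proof
    assume t: "triangle F x y z"
    have "\<exists>a. F r a > 0 \<and> F j a > 0 \<and> F j r > 0"
      using nt[OF t] t that unfolding triangle_def by blast
    then show False using pr neg by (metis less_asym)
  qed
qed

lemma weak_fork_similar:
  assumes "weak_fork n r P" "similar_quivers n P P'"
  shows "\<exists>r'. weak_fork n r' P'"
proof -
  obtain \<sigma> \<epsilon> where *: "\<sigma> permutes {1..n}" "\<epsilon> = 1 \<or> \<epsilon> = - 1" "P' = (\<lambda>i j. \<epsilon> * P (\<sigma> i) (\<sigma> j))"
    using assms(2) unfolding similar_quivers_def by blast
  define r' where "r' = inv \<sigma> r"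
  have r: "\<sigma> r' = r" unfolding r'_def using permutes_inverses[OF *(1)] by simp
  have inj: "\<sigma> x = \<sigma> y \<longleftrightarrow> x = y" for x y
    using permutes_inj[OF *(1)] by (simp add: inj_eq)
  have pr: "P l i > P i r" "P l i > P r l" if "P i r > 0" "P r l > 0" for i l
    using assms(1) that unfolding weak_fork_def abundant_def by blast+
  have q: "quiver_on n P" and ab: "abundant n P"
    using assms(1) unfolding weak_fork_def abundant_def by blast+
  have nt: "x = r \<or> y = r \<or> z = r" if "triangle P x y z" for x y z
    using assms(1) that unfolding weak_fork_def by blast
  have "abundant n P'"
    unfolding abundant_def
  proof (intro conjI ballI impI)
    show "quiver_on n P'" by (rule quiver_on_similar[OF assms(2) q])
    fix x y assume "x \<in> {1..n}" "y \<in> {1..n}" "x \<noteq> y"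
    then have "\<bar>P (\<sigma> x) (\<sigma> y)\<bar> \<ge> 2"
      using ab permutes_in_image[OF *(1)] inj unfolding abundant_def by blast
    then show "\<bar>P' x y\<bar> \<ge> 2" using *(2,3) by auto
  qed
  moreover have "P' l i > P' i r' \<and> P' l i > P' r' l" if "P' i r' > 0" "P' r' l > 0" for i l
    using *(2)
  proof
    assume "\<epsilon> = 1"
    then show ?thesis using that pr[of "\<sigma> i" "\<sigma> l"] by (simp add: *(3) r)
  next
    assume "\<epsilon> = - 1"
    then show ?thesis
      using that pr[of "\<sigma> l" "\<sigma> i"] quiver_on_skew[OF q, of "\<sigma> i" r] quiver_on_skew[OF q, of r "\<sigma> l"]
        quiver_on_skew[OF q, of "\<sigma> i" "\<sigma> l"] by (simp add: *(3) r)
  qed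
  moreover have "\<not> triangle P' x y z" if "x \<noteq> r'" "y \<noteq> r'" "z \<noteq> r'" for x y z
  proof
    assume t: "triangle P' x y z"
    have ne: "\<sigma> x \<noteq> r" "\<sigma> y \<noteq> r" "\<sigma> z \<noteq> r" using that inj r by metis+
    show False
      using *(2)
    proof
      assume "\<epsilon> = 1"
      then have "triangle P (\<sigma> x) (\<sigma> y) (\<sigma> z)" using t by (simp add: triangle_def *(3))
      then show False using nt ne by blast
    next
      assume "\<epsilon> = - 1"
      then have "triangle P (\<sigma> y) (\<sigma> x) (\<sigma> z)"
        using t quiver_on_skew[OF q, of "\<sigma> y" "\<sigma> x"] quiver_on_skew[OF q, of "\<sigma> x" "\<sigma> z"]
          quiver_on_skew[OF q, of "\<sigma> z" "\<sigma> y"] by (simp add: triangle_def *(3))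
      then show False using nt ne by blast
    qed
  qed
  ultimately show ?thesis
    unfolding weak_fork_def by blast
qed

text \<open>Indexing by the integers lets the walk be followed from its base in both directions, and
  lets periodicity contradict a walk that never returns.\<close>

locale reduced_closed_walk =
  fixes n L :: nat and Q :: quiver and w :: "int \<Rightarrow> quiver set"
  assumes Q: "quiver_on n Q"
    and edge: "\<And>i. {w i, w (i + 1)} \<in> Gamma_edges n Q"
    and reduced: "\<And>i. w i \<noteq> w (i + 2)"
    and periodic: "\<And>i. w (i + int L) = w i" and L_pos: "L > 0"
    and base: "w 0 = quiver_class n Q"
    and not_fork: "\<And>r. \<not> weak_fork n r Q"
begin

lemma periodic_mult: "w (int L * int m) = quiver_class n Q"
proof (induction m)
  case (Suc m)
  then show ?case using periodic[of "int L * int m"] by (simp add: algebra_simps)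
qed (simp add: base)

text \<open>Mutating a fork anywhere but at its point of return gives a fork again, so a reduced walk that
  enters a fork at its point of return never leaves the forks.\<close>

lemma fork_trap:
  assumes "weak_fork n r F" "w i = quiver_class n F" "w (i - 1) = quiver_class n (mutate r F)"
  shows False
proof -
  have "\<exists>r F. weak_fork n r F \<and> w (i + int m) = quiver_class n F \<and>
          w (i + int m - 1) = quiver_class n (mutate r F)" for m
  proof (induction m)
    case 0
    then show ?case using assms by auto
  next
    case (Suc m)
    then obtain r F where F: "weak_fork n r F" "w (i + int m) = quiver_class n F"
      "w (i + int m - 1) = quiver_class n (mutate r F)" by blast
    have qF: "quiver_on n F" using F(1) by (simp add: weak_fork_def abundant_def)
    obtain j where j: "j \<in> {1..n}" "w (i + int m + 1) = quiver_class n (mutate j F)"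
      using Gamma_edge_mutate[OF Q qF] edge[of "i + int m"] F(2) by metis
    have "w (i + int m - 1) \<noteq> w (i + int m + 1)"
      using reduced[of "i + int m - 1"] by (simp add: algebra_simps)
    then have "j \<noteq> r" using F(3) j(2) by metis
    then have "weak_fork n j (mutate j F)" by (rule weak_fork_mutate[OF F(1) j(1)])
    moreover have "w (i + int (Suc m)) = quiver_class n (mutate j F)"
      using j(2) by (simp add: algebra_simps)
    moreover have "w (i + int (Suc m) - 1) = quiver_class n (mutate j (mutate j F))"
      using F(2) mutate_mutate[OF qF] by simp
    ultimately show ?case by blast
  qed
  note all = this
  \<comment> \<open>A multiple of \<open>L\<close> not before \<open>i\<close>: there the trapped
    walk is back at the class of \<open>Q\<close>.\<close>
  have "int L * int (nat \<bar>i\<bar>) \<ge> \<bar>i\<bar>"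
    using L_pos mult_right_mono[of 1 "int L" "\<bar>i\<bar>"] by simp
  then have "i + int (nat (int L * int (nat \<bar>i\<bar>) - i)) = int L * int (nat \<bar>i\<bar>)"
    by linarith
  then obtain m where "i + int m = int L * int (nat \<bar>i\<bar>)"
    by blast
  then obtain r F where "weak_fork n r F" "quiver_class n Q = quiver_class n F"
    using all[of m] periodic_mult by metis
  then show False
    using weak_fork_similar[of n r F Q] not_fork quiver_class_eq_iff by metis
qed

text \<open>At \<open>S t\<close> a reduced walk cannot undo the mutation at
  \<open>v (t - 1)\<close>, and any vertex other than \<open>v t\<close> leads into
  \<open>fork_trap\<close>. The condition \<open>side\<close> starts at \<open>t = 1\<close> because
  the first step is given.\<close>

lemma forced_walk:
  assumes S0: "quiver_on n (S 0)" "w 0 = quiver_class n (S 0)" "w 1 = quiver_class n (S 1)"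
    and step: "\<And>t. t < M \<Longrightarrow> S (Suc t) = mutate (v t) (S t)"
    and side: "\<And>t j. 0 < t \<Longrightarrow> t < M \<Longrightarrow> j \<in> {1..n} \<Longrightarrow> j \<noteq> v (t - 1) \<Longrightarrow> j \<noteq> v t \<Longrightarrow>
      weak_fork n j (mutate j (S t))"
  shows "t \<le> M \<Longrightarrow> w (int t) = quiver_class n (S t)"
proof (induction t rule: less_induct)
  case (less t)
  have qS: "quiver_on n (S s)" if "s \<le> M" for s
    using that by (induction s) (auto simp: S0(1) step quiver_on_mutate)
  consider "t = 0" | "t = 1" | s where "t = Suc (Suc s)"
    by (metis One_nat_def not0_implies_Suc)
  then show ?case
  proof cases
    case 3
    have ws: "w (int s) = quiver_class n (S s)" "w (int s + 1) = quiver_class n (S (Suc s))"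
      using less.IH[of s] less.IH[of "Suc s"] less.prems 3 by (auto simp: add.commute)
    have qs: "quiver_on n (S (Suc s))" using qS less.prems 3 by simp
    obtain j where j: "j \<in> {1..n}" "w (int s + 2) = quiver_class n (mutate j (S (Suc s)))"
      using Gamma_edge_mutate[OF Q qs] edge[of "int s + 1"] ws(2) by (metis add.assoc one_add_one)
    have "mutate (v s) (S (Suc s)) = S s"
      using step[of s] mutate_mutate qS[of s] less.prems 3 by simp
    then have "j \<noteq> v s"
      using reduced[of "int s"] ws(1) j(2) by metis
    moreover have False if "j \<noteq> v s" "j \<noteq> v (Suc s)"
    proof (rule fork_trap)
      show "weak_fork n j (mutate j (S (Suc s)))"
        using side[of "Suc s" j] that j(1) less.prems 3 by simp
      show "w (int s + 2) = quiver_class n (mutate j (S (Suc s)))" by (rule j(2))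
      show "w (int s + 2 - 1) = quiver_class n (mutate j (mutate j (S (Suc s))))"
        using ws(2) mutate_mutate[OF qs] by (simp add: add.commute)
    qed
    ultimately have "j = v (Suc s)" by blast
    then show ?thesis
      using j(2) step[of "Suc s"] less.prems 3 by (simp add: add.commute)
  qed (use S0 in auto)
qed

lemma first_step:
  assumes "\<And>j. j \<in> {1..n} \<Longrightarrow> j \<noteq> a \<Longrightarrow> j \<noteq> b \<Longrightarrow> weak_fork n j (mutate j Q)"
  shows "w 1 = quiver_class n (mutate a Q) \<or> w 1 = quiver_class n (mutate b Q)"
proof -
  have "{quiver_class n Q, w 1} \<in> Gamma_edges n Q"
    using edge[of 0] base by simp
  then obtain j where j: "j \<in> {1..n}" "w 1 = quiver_class n (mutate j Q)"
    using Gamma_edge_mutate[OF Q Q] by metis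
  have "j = a \<or> j = b"
  proof (rule ccontr)
    assume "\<not> (j = a \<or> j = b)"
    then have "weak_fork n j (mutate j Q)" using assms j(1) by blast
    from fork_trap[OF this j(2)] show False
      using base mutate_mutate[OF Q] by simp
  qed
  then show ?thesis using j(2) by auto
qed

lemma reverse: "reduced_closed_walk n L Q (\<lambda>i. w (- i))"
proof unfold_locales
  show "{w (- i), w (- (i + 1))} \<in> Gamma_edges n Q" for i
    using edge[of "- i - 1"] by (simp add: insert_commute)
  show "w (- i) \<noteq> w (- (i + 2))" for i
    using reduced[of "- i - 2"] by simp
  show "w (- (i + int L)) = w (- i)" for i
    using periodic[of "- i - int L"] by simp
qed (use Q L_pos base not_fork in auto)

end

lemma reduced_closed_walk_of_cycle:
  assumes c: "graph_cycle (Gamma_edges n Q) c" "quiver_class n Q \<in> set c"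
    and Q: "quiver_on n Q" "\<And>r. \<not> weak_fork n r Q"
  obtains w where "reduced_closed_walk n (length c) Q w"
proof -
  obtain i0 where i0: "i0 < length c" "c ! i0 = quiver_class n Q"
    using c(2) by (metis in_set_conv_nth)
  define L where "L = length c"
  have L: "L > 0" using i0(1) by (cases c) (auto simp: L_def)
  define w where "w = (\<lambda>i. c ! nat ((i + int i0) mod int L))"
  have cyc: "w (i + int m) = cyc_nth c (nat ((i + int i0) mod int L) + m)" for i m
  proof -
    define a where "a = nat ((i + int i0) mod int L)"
    have "int a = (i + int i0) mod int L" using L by (simp add: a_def)
    then have "int ((a + m) mod L) = (i + int m + int i0) mod int L"
      using mod_add_right_eq[of "int m" "i + int i0" "int L"]
      by (simp add: zmod_int algebra_simps)
    then have "nat ((i + int m + int i0) mod int L) = (a + m) mod L"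
      by (metis nat_int)
    then show ?thesis
      unfolding w_def cyc_nth_def a_def L_def by simp
  qed
  have "reduced_closed_walk n L Q w"
  proof
    fix i
    define a where "a = nat ((i + int i0) mod int L)"
    have w: "w i = cyc_nth c a" "w (i + 1) = cyc_nth c (a + 1)" "w (i + 2) = cyc_nth c (a + 2)"
      using cyc[of i 0] cyc[of i 1] cyc[of i 2] by (auto simp: a_def)
    show "{w i, w (i + 1)} \<in> Gamma_edges n Q" "w i \<noteq> w (i + 2)"
      using c(1) unfolding w graph_cycle_def by (auto simp: insert_commute)
    have "i + int L + int i0 = i + int i0 + int L" by simp
    then show "w (i + int L) = w i"
      unfolding w_def by (metis mod_add_self2)
  next
    show "w 0 = quiver_class n Q" using i0 by (simp add: w_def L_def)
  qed (use Q L in auto)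
  then show thesis using that L_def by blast
qed

text \<open>Followed from \<open>Q\<close> in both directions, the cycle runs along \<open>S\<close>
  one way and \<open>T\<close> the other, so every split of its length into \<open>s + t\<close>
  within \<open>Ma\<close> and \<open>Mb\<close> makes \<open>S s\<close> and \<open>T t\<close>
  similar.\<close>

lemma no_short_cycle:
  assumes Q: "quiver_on n Q" "\<And>r. \<not> weak_fork n r Q"
    and side0: "\<And>j. j \<in> {1..n} \<Longrightarrow> j \<noteq> va 0 \<Longrightarrow> j \<noteq> vb 0 \<Longrightarrow> weak_fork n j (mutate j Q)"
    and S0: "S 0 = Q" and S: "\<And>t. t < Ma \<Longrightarrow> S (Suc t) = mutate (va t) (S t)"
    and sideS: "\<And>t j. 0 < t \<Longrightarrow> t < Ma \<Longrightarrow> j \<in> {1..n} \<Longrightarrow> j \<noteq> va (t - 1) \<Longrightarrow> j \<noteq> va t \<Longrightarrow>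
      weak_fork n j (mutate j (S t))"
    and T0: "T 0 = Q" and T: "\<And>t. t < Mb \<Longrightarrow> T (Suc t) = mutate (vb t) (T t)"
    and sideT: "\<And>t j. 0 < t \<Longrightarrow> t < Mb \<Longrightarrow> j \<in> {1..n} \<Longrightarrow> j \<noteq> vb (t - 1) \<Longrightarrow> j \<noteq> vb t \<Longrightarrow>
      weak_fork n j (mutate j (T t))"
    and pos: "Ma > 0" "Mb > 0"
    and distinct: "\<And>l. 3 \<le> l \<Longrightarrow> l \<le> B \<Longrightarrow>
      \<exists>s\<le>Ma. \<exists>t\<le>Mb. s + t = l \<and> \<not> similar_quivers n (S s) (T t)"
    and c: "graph_cycle (Gamma_edges n Q) c" "length c \<le> B"
  shows "quiver_class n Q \<notin> set c"
proof
  have ST1: "S 1 = mutate (va 0) Q" "T 1 = mutate (vb 0) Q"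
    using S[of 0] T[of 0] S0 T0 pos by auto
  assume "quiver_class n Q \<in> set c"
  then obtain w where "reduced_closed_walk n (length c) Q w"
    using reduced_closed_walk_of_cycle[OF c(1) _ Q] by blast
  moreover have False
    if w: "reduced_closed_walk n (length c) Q w" and w1: "w 1 = quiver_class n (S 1)" for w
  proof -
    interpret reduced_closed_walk n "length c" Q w by (rule w)
    interpret rev: reduced_closed_walk n "length c" Q "\<lambda>i. w (- i)" by (rule reverse)
    have "w 1 \<noteq> w (- 1)" using reduced[of "- 1"] by simp
    then have w1': "w (- 1) = quiver_class n (T 1)"
      using rev.first_step[where a = "va 0" and b = "vb 0", OF side0] w1 ST1 by simp
    have wS: "w (int t) = quiver_class n (S t)" if "t \<le> Ma" for t
      by (rule forced_walk[where v = va and M = Ma]) (use S0 Q(1) base w1 S sideS that in \<open>simp_all\<close>)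
    have wT: "w (- int t) = quiver_class n (T t)" if "t \<le> Mb" for t
      by (rule rev.forced_walk[where v = vb and M = Mb]) (use T0 Q(1) base w1' T sideT that in \<open>simp_all\<close>)
    have "w 0 \<noteq> w 1" "w 0 \<noteq> w 2"
      using edge[of 0] reduced[of 0] Gamma_edges_irrefl[of "w 0" "w 1"] by auto
    then have "length c \<noteq> 1" "length c \<noteq> 2"
      using periodic[of 0] by (metis add_0 of_nat_1, metis add_0 of_nat_numeral)
    then have "3 \<le> length c" using L_pos by linarith
    then obtain s t where st: "s \<le> Ma" "t \<le> Mb" "s + t = length c" "\<not> similar_quivers n (S s) (T t)"
      using distinct[OF _ c(2)] by blast
    have "w (int s) = w (- int t)"
    proof -
      have "int s = - int t + int (length c)" using st(3) by linarith
      then show ?thesis using periodic[of "- int t"] by metis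
    qed
    then show False
      using wS[OF st(1)] wT[OF st(2)] st(4) by (simp add: quiver_class_eq_iff)
  qed
  note no = this
  ultimately show False
  proof -
    assume w: "reduced_closed_walk n (length c) Q w"
    interpret reduced_closed_walk n "length c" Q w by (rule w)
    interpret rev: reduced_closed_walk n "length c" Q "\<lambda>i. w (- i)" by (rule reverse)
    \<comment> \<open>Up to reversal the walk starts along \<open>S\<close>: its two neighbours at
      the base are distinct, so they cannot both be the class of \<open>T 1\<close>.\<close>
    show False
      using first_step[where a = "va 0" and b = "vb 0", OF side0]
        rev.first_step[where a = "va 0" and b = "vb 0", OF side0] no[OF w] no[OF reverse]
        reduced[of "- 1"] ST1 by simp metis
  qed
qed

section \<open>Side mutations from the stages of the rank 2 orbit\<close>

text \<open>Chebyshev-type recurrence for the entries between a third vertex and two vertices joined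
  by \<open>a\<close> arrows, under alternating mutations at the two.\<close>

fun rec2 :: "int \<Rightarrow> int \<Rightarrow> int \<Rightarrow> nat \<Rightarrow> int" where
  "rec2 a x y 0 = x"
| "rec2 a x y (Suc 0) = y"
| "rec2 a x y (Suc (Suc m)) = a * rec2 a x y (Suc m) - rec2 a x y m"

lemma rec2_mono:
  assumes "a \<ge> 2" "x \<le> - 2" "y \<ge> 2"
  shows "rec2 a x y (Suc m) \<ge> 2 \<and> rec2 a x y (Suc (Suc m)) > rec2 a x y (Suc m)"
proof (induction m)
  case 0
  have "a * y \<ge> 2 * a" "a * y \<ge> 2 * y" using mult_ge_twice[of a y] assms by auto
  then show ?case using assms unfolding rec2.simps by linarith
next
  case (Suc m)
  then have "a * rec2 a x y (Suc (Suc m)) \<ge> 2 * rec2 a x y (Suc (Suc m))"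
    using assms by (intro mult_ge_twice) auto
  then show ?case using Suc by simp
qed

lemma rec2_gt_coeff:
  assumes "a \<ge> 2" "x \<le> - 2" "y \<ge> 2"
  shows "rec2 a x y (Suc (Suc m)) > a"
proof (induction m)
  case 0
  have "a * y \<ge> 2 * a" using mult_ge_twice[of a y] assms by auto
  then show ?case using assms unfolding rec2.simps by linarith
next
  case (Suc m)
  then show ?case using rec2_mono[OF assms, of "Suc m"] by linarith
qed

text \<open>As functions of \<open>m\<close> both sides solve the same second-order recurrence and
  agree at 0 and 1. Exchanging the two sequences allows one quiver to be computed from both ends of
  the long cycle.\<close>

lemma rec2_wronskian:
  "y' * rec2 a x y (Suc m) - x' * rec2 a x y m = y * rec2 a x' y' (Suc m) - x * rec2 a x' y' m"
proof (induction m rule: induct_nat_012)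
  case (ge2 m)
  have "y' * rec2 a x y (Suc (Suc (Suc m))) - x' * rec2 a x y (Suc (Suc m)) =
      a * (y' * rec2 a x y (Suc (Suc m)) - x' * rec2 a x y (Suc m)) -
      (y' * rec2 a x y (Suc m) - x' * rec2 a x y m)"
    by (simp add: algebra_simps)
  also have "\<dots> = a * (y * rec2 a x' y' (Suc (Suc m)) - x * rec2 a x' y' (Suc m)) -
      (y * rec2 a x' y' (Suc m) - x * rec2 a x' y' m)"
    using ge2 by simp
  finally show ?case by (simp add: algebra_simps)
qed (simp_all add: algebra_simps)

text \<open>The quivers met along the mutations at 1 and 2, where \<open>{s, r} = {1, 2}\<close>. The vertices
  \<open>3, \<dots>, n - 1\<close> behave alike and their mutual arrows \<open>W\<close> never change.\<close>

definition described ::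
  "nat \<Rightarrow> quiver \<Rightarrow> quiver \<Rightarrow> nat \<Rightarrow> nat \<Rightarrow> int \<Rightarrow> (nat \<Rightarrow> int) \<Rightarrow> (nat \<Rightarrow> int) \<Rightarrow> int \<Rightarrow> int \<Rightarrow> (nat \<Rightarrow> int) \<Rightarrow> bool"
where
  "described n W S s r \<alpha> p q u v y \<longleftrightarrow> quiver_on n S \<and> n \<ge> 4 \<and> (s = 1 \<and> r = 2 \<or> s = 2 \<and> r = 1) \<and>
     S s r = \<alpha> \<and> S n s = u \<and> S n r = v \<and>
     (\<forall>j\<in>{3..<n}. S s j = p j \<and> S r j = q j \<and> S n j = y j \<and> (\<forall>i\<in>{3..<n}. S i j = W i j))"

lemma describedD:
  assumes "described n W S s r \<alpha> p q u v y"
  shows "quiver_on n S" "n \<ge> 4" "s = 1 \<and> r = 2 \<or> s = 2 \<and> r = 1"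
    "S s r = \<alpha>" "S r s = - \<alpha>" "S n s = u" "S s n = - u" "S n r = v" "S r n = - v" "S i i = 0"
    "j \<in> {3..<n} \<Longrightarrow> S s j = p j" "j \<in> {3..<n} \<Longrightarrow> S j s = - p j"
    "j \<in> {3..<n} \<Longrightarrow> S r j = q j" "j \<in> {3..<n} \<Longrightarrow> S j r = - q j"
    "j \<in> {3..<n} \<Longrightarrow> S n j = y j" "j \<in> {3..<n} \<Longrightarrow> S j n = - y j"
    "i \<in> {3..<n} \<Longrightarrow> j \<in> {3..<n} \<Longrightarrow> S i j = W i j"
proof -
  have q: "quiver_on n S" using assms by (simp add: described_def)
  note skew = quiver_on_skew[OF q]
  show "quiver_on n S" "n \<ge> 4" "s = 1 \<and> r = 2 \<or> s = 2 \<and> r = 1"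
    "S s r = \<alpha>" "S n s = u" "S n r = v"
    "j \<in> {3..<n} \<Longrightarrow> S s j = p j" "j \<in> {3..<n} \<Longrightarrow> S r j = q j" "j \<in> {3..<n} \<Longrightarrow> S n j = y j"
    "i \<in> {3..<n} \<Longrightarrow> j \<in> {3..<n} \<Longrightarrow> S i j = W i j"
    using assms unfolding described_def by blast+
  then show "S r s = - \<alpha>" "S s n = - u" "S r n = - v"
    "j \<in> {3..<n} \<Longrightarrow> S j s = - p j" "j \<in> {3..<n} \<Longrightarrow> S j r = - q j" "j \<in> {3..<n} \<Longrightarrow> S j n = - y j"
    using skew by metis+
  show "S i i = 0" using skew[of i i] by simp
qed

lemma described_vertex:
  assumes "described n W S s r \<alpha> p q u v y" "x \<in> {1..n}"
  shows "x = s \<or> x = r \<or> x = n \<or> x \<in> {3..<n}"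
  using describedD(3)[OF assms(1)] assms(2) by auto

lemma described_cong:
  assumes "described n W S s r \<alpha> p q u v y" "\<alpha> = \<alpha>'" "u = u'" "v = v'"
    "\<And>j. j \<in> {3..<n} \<Longrightarrow> p j = p' j" "\<And>j. j \<in> {3..<n} \<Longrightarrow> q j = q' j" "\<And>j. j \<in> {3..<n} \<Longrightarrow> y j = y' j"
  shows "described n W S s r \<alpha>' p' q' u' v' y'"
  using assms unfolding described_def by simp

lemma described_swap:
  assumes "described n W S s r \<alpha> p q u v y"
  shows "described n W S r s (- \<alpha>) q p v u y"
  unfolding described_def using describedD[OF assms] by auto

lemma described_unique:
  assumes S: "described n W S s r \<alpha> p q u v y" and S': "described n W S' s r \<alpha> p q u v y"
  shows "S = S'"
proof (intro ext)
  fix i j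
  show "S i j = S' i j"
  proof (cases "i \<in> {1..n} \<and> j \<in> {1..n}")
    case True
    then have "i = s \<or> i = r \<or> i = n \<or> i \<in> {3..<n}" "j = s \<or> j = r \<or> j = n \<or> j \<in> {3..<n}"
      using described_vertex[OF S] by blast+
    then show ?thesis
      by (elim disjE) (simp_all add: describedD[OF S] describedD[OF S'])
  next
    case False
    then show ?thesis
      using quiver_on_outside[OF describedD(1)[OF S], of i j] quiver_on_outside[OF describedD(1)[OF S'], of i j]
      by force
  qed
qed

text \<open>Since 3, ..., n - 1 all lie on the same side of \<open>r\<close>, no path through
  \<open>r\<close> joins two of them and \<open>W\<close> survives. The roles of \<open>s\<close>
  and \<open>r\<close> are exchanged, so the next alternating mutation is again at the second
  vertex.\<close>

lemma described_mutate:
  assumes S: "described n W S s r \<alpha> p q u v y"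
    and q: "(\<forall>j\<in>{3..<n}. q j > 0) \<or> (\<forall>j\<in>{3..<n}. q j < 0)"
  shows "described n W (mutate r S) r s \<alpha> (\<lambda>j. - q j) (\<lambda>j. p j + mut_term \<alpha> (q j))
     (- v) (u + mut_term v (- \<alpha>)) (\<lambda>j. y j + mut_term v (q j))"
proof -
  have D: "n \<ge> 4" "s = 1 \<and> r = 2 \<or> s = 2 \<and> r = 1" using describedD[OF S] by blast+
  have ne: "s \<noteq> r" "n \<noteq> r" "n \<noteq> s" "j \<in> {3..<n} \<Longrightarrow> j \<noteq> r" for j using D by auto
  have zero: "mut_term (- q i) (q j) = 0" if "i \<in> {3..<n}" "j \<in> {3..<n}" for i j
  proof -
    have "q i > 0 \<and> q j > 0 \<or> q i < 0 \<and> q j < 0" using q that by blast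
    then show ?thesis by (auto simp: mut_term_def)
  qed
  note D' = describedD(4-17)[OF S]
  have r: "mutate r S r x = - S r x" "mutate r S x r = - S x r" for x
    by (simp_all add: mutate_eq)
  have other: "mutate r S x z = S x z + mut_term (S x r) (S r z)" if "x \<noteq> r" "z \<noteq> r" for x z
    using that by (simp add: mutate_eq)
  have "mutate r S r s = \<alpha>" "mutate r S n r = - v" "mutate r S n s = u + mut_term v (- \<alpha>)"
    using ne by (simp_all only: r other D' minus_minus not_False_eq_True)
  moreover have "mutate r S r j = - q j" "mutate r S s j = p j + mut_term \<alpha> (q j)"
    "mutate r S n j = y j + mut_term v (q j)" if "j \<in> {3..<n}" for j
    using ne(4)[OF that] ne(1-3) that by (simp_all only: r other D' not_False_eq_True)
  moreover have "mutate r S i j = W i j" if "i \<in> {3..<n}" "j \<in> {3..<n}" for i j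
    using ne(4)[OF that(1)] ne(4)[OF that(2)] that
    by (simp only: other D' zero not_False_eq_True add_0_right)
  ultimately show ?thesis
    using D quiver_on_mutate[OF describedD(1)[OF S]] unfolding described_def by blast
qed

lemma described_abundant:
  assumes S: "described n W S s r \<alpha> p q u v y"
    and "\<bar>\<alpha>\<bar> \<ge> 2" "\<bar>u\<bar> \<ge> 2" "\<bar>v\<bar> \<ge> 2"
    "\<And>j. j \<in> {3..<n} \<Longrightarrow> \<bar>p j\<bar> \<ge> 2" "\<And>j. j \<in> {3..<n} \<Longrightarrow> \<bar>q j\<bar> \<ge> 2" "\<And>j. j \<in> {3..<n} \<Longrightarrow> \<bar>y j\<bar> \<ge> 2"
    and W: "\<And>i j. i \<in> {3..<n} \<Longrightarrow> j \<in> {3..<n} \<Longrightarrow> i < j \<Longrightarrow> W i j \<ge> 2"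
  shows "abundant n S"
  unfolding abundant_def
proof (intro conjI ballI impI describedD(1)[OF S])
  have W2: "\<bar>W i j\<bar> \<ge> 2" if "i \<in> {3..<n}" "j \<in> {3..<n}" "i \<noteq> j" for i j
  proof -
    have "W i j = - W j i"
      using quiver_on_skew[OF describedD(1)[OF S], of i j]
        describedD(17)[OF S that(1,2)] describedD(17)[OF S that(2,1)] by metis
    then show ?thesis using W[of i j] W[of j i] that by linarith
  qed
  fix x z assume "x \<in> {1..n}" "z \<in> {1..n}" "x \<noteq> z"
  moreover from this have "x = s \<or> x = r \<or> x = n \<or> x \<in> {3..<n}" "z = s \<or> z = r \<or> z = n \<or> z \<in> {3..<n}"
    using described_vertex[OF S] by blast+
  ultimately show "\<bar>S x z\<bar> \<ge> 2"
    by (elim disjE) (simp_all add: describedD[OF S] assms W2)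
qed

text \<open>\<open>P\<close> selects one rotation of each oriented triangle, so that the conditions
  of \<open>weak_fork_mutateI\<close> need only be checked on an explicit list; \<open>wt\<close>
  covers the three positions of \<open>w\<close>.\<close>

lemma weak_fork_mutate_by_triangles:
  assumes S: "abundant n S" and w: "w \<in> {1..n}"
    and P: "\<And>x y z. triangle S x y z \<Longrightarrow> P x y z \<or> P y z x \<or> P z x y"
    and io: "\<And>x y z. P x y z \<Longrightarrow> triangle S x y z \<Longrightarrow> w \<notin> {x, y, z} \<Longrightarrow>
      \<not> (S x w > 0 \<and> S y w > 0 \<and> S z w > 0) \<and> \<not> (S w x > 0 \<and> S w y > 0 \<and> S w z > 0)"
    and wt: "\<And>x y z. P x y z \<Longrightarrow> triangle S x y z \<Longrightarrow>
      (w = y \<longrightarrow> S x y * S y z - S z x > S x y \<and> S x y * S y z - S z x > S y z) \<and>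
      (w = x \<longrightarrow> S z x * S x y - S y z > S z x \<and> S z x * S x y - S y z > S x y) \<and>
      (w = z \<longrightarrow> S y z * S z x - S x y > S y z \<and> S y z * S z x - S x y > S z x)"
  shows "weak_fork n w (mutate w S)"
proof (rule weak_fork_mutateI[OF S w])
  fix i l assume t: "triangle S i w l"
  then have t': "triangle S w l i" "triangle S l i w" by (auto simp: triangle_def)
  from P[OF t] show "S i w * S w l - S l i > S i w \<and> S i w * S w l - S l i > S w l"
    using wt[OF _ t] wt[OF _ t'(1)] wt[OF _ t'(2)] by blast
next
  have Sw: "S w w = 0" using S quiver_on_skew[of n S w w] by (simp add: abundant_def)
  have io': "\<not> (S x w > 0 \<and> S y w > 0 \<and> S z w > 0) \<and> \<not> (S w x > 0 \<and> S w y > 0 \<and> S w z > 0)"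
    if t: "triangle S x y z" for x y z
  proof (cases "w \<in> {x, y, z}")
    case True
    then show ?thesis using Sw by auto
  next
    case False
    then show ?thesis
      using P[OF t] io[OF _ t] io[OF _ triangle_rotate[OF t]]
        io[OF _ triangle_rotate[OF triangle_rotate[OF t]]] by blast
  qed
  show "\<not> triangle S x y z" if "S x w > 0" "S y w > 0" "S z w > 0" for x y z
    using io' that by blast
  show "\<not> triangle S x y z" if "S w x > 0" "S w y > 0" "S w z > 0" for x y z
    using io' that by blast
qed

lemma fork_weights:
  fixes a p q :: int
  assumes "q \<ge> 2" "p > a" "p > q"
  shows "p * q - a > p \<and> p * q - a > q"
  using mult_ge_twice[of p q] assms by linarith

lemma acyclic_block:
  assumes S: "described n W S s r \<alpha> p q u v y"
    and W: "\<And>i j. i \<in> {3..<n} \<Longrightarrow> j \<in> {3..<n} \<Longrightarrow> i < j \<Longrightarrow> W i j \<ge> 2"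
    and "S i j > 0" "i \<in> {3..<n}" "j \<in> {3..<n}"
  shows "i < j"
proof (rule ccontr)
  assume "\<not> i < j"
  then consider "i = j" | "j < i" by linarith
  then show False
  proof cases
    case 1
    then show ?thesis using assms(3) describedD(10)[OF S] by simp
  next
    case 2
    then show ?thesis
      using W[of j i] assms(3-5) quiver_on_skew[OF describedD(1)[OF S], of i j] describedD(17)[OF S, of j i] by simp
  qed
qed

section \<open>Oriented triangles and forks at a single stage\<close>

text \<open>The triangles r -> s -> j -> r are oriented with weights \<open>a\<close>,
  \<open>p j\<close>, \<open>q j\<close>. The arrow s -> j opposite \<open>r\<close> is the
  heaviest, so the part without \<open>n\<close> is a fork with point of return \<open>r\<close>.
  The lemmas below differ in the signs at \<open>n\<close>.\<close>

locale cyclic_stage =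
  fixes n :: nat and W S :: quiver and s r :: nat and a :: int and p q :: "nat \<Rightarrow> int" and u v :: int and y :: "nat \<Rightarrow> int"
  assumes desc: "described n W S s r (- a) p (\<lambda>j. - q j) u v y"
    and W: "\<And>i j. i \<in> {3..<n} \<Longrightarrow> j \<in> {3..<n} \<Longrightarrow> i < j \<Longrightarrow> W i j \<ge> 2"
    and a: "a \<ge> 2"
    and pq: "\<And>j. j \<in> {3..<n} \<Longrightarrow> q j \<ge> 2" "\<And>j. j \<in> {3..<n} \<Longrightarrow> p j > q j" "\<And>j. j \<in> {3..<n} \<Longrightarrow> p j > a"
    and uvy: "\<bar>u\<bar> \<ge> 2" "\<bar>v\<bar> \<ge> 2" "\<And>j. j \<in> {3..<n} \<Longrightarrow> \<bar>y j\<bar> \<ge> 2"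
begin

lemmas D = describedD[OF desc]

lemma abundant_stage: "abundant n S"
  by (rule described_abundant[OF desc _ uvy(1,2) _ _ uvy(3) W]) (use a pq in force)+

lemma pos: "j \<in> {3..<n} \<Longrightarrow> p j > 0 \<and> q j > 0" for j
  using pq[of j] by force

lemma block: "S i j > 0 \<Longrightarrow> i \<in> {3..<n} \<Longrightarrow> j \<in> {3..<n} \<Longrightarrow> i < j" for i j
  using acyclic_block[OF desc W] by blast

lemma weights: "j \<in> {3..<n} \<Longrightarrow> p j * q j - a > p j \<and> p j * q j - a > q j"
  by (rule fork_weights[OF pq(1,3,2)])

abbreviation "B \<equiv> {3..<n}"

lemma B_facts: "n \<notin> B" "s \<notin> B" "r \<notin> B" "n \<noteq> s" "n \<noteq> r" "s \<noteq> r" "s \<in> {1..n}" "r \<in> {1..n}" "n \<in> {1..n}"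
  using D(2,3) by auto

lemma arrow_ends:
  assumes "S x z > 0"
  shows "x = s \<or> x = r \<or> x = n \<or> x \<in> B" "z = s \<or> z = r \<or> z = n \<or> z \<in> B"
proof -
  have "x \<in> {1..n}" "z \<in> {1..n}" using quiver_on_outside[OF D(1), of x z] assms by auto
  then show "x = s \<or> x = r \<or> x = n \<or> x \<in> B" "z = s \<or> z = r \<or> z = n \<or> z \<in> B"
    using described_vertex[OF desc] by blast+
qed

text \<open>A rank that rises along every arrow, except those from \<open>Z\<close> to
  \<open>s\<close>, forces each oriented triangle to use such an exception.\<close>

lemma triangle_by_rank:
  fixes \<phi> :: "nat \<Rightarrow> nat"
  assumes rank: "\<And>x z. S x z > 0 \<Longrightarrow> \<phi> x < \<phi> z \<or> x \<in> Z \<and> z = s"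
    and t: "triangle S x1 x2 x3"
  shows "\<exists>j z. z \<in> Z \<and> S s j > 0 \<and> S j z > 0 \<and> (x1, x2, x3) \<in> {(s, j, z), (j, z, s), (z, s, j)}"
proof -
  have "x1 \<in> Z \<and> x2 = s \<or> x2 \<in> Z \<and> x3 = s \<or> x3 \<in> Z \<and> x1 = s"
    using rank[of x1 x2] rank[of x2 x3] rank[of x3 x1] t unfolding triangle_def by linarith
  then show ?thesis using t unfolding triangle_def by blast
qed

text \<open>Here s -> n -> r, so \<open>n\<close> acts like one more block vertex, ranked before or
  after the block according to the sign of \<open>y\<close>; only r -> s goes down.\<close>

lemma triangles_mixed:
  assumes "u < 0" "v > 0" "(\<forall>j\<in>B. y j > 0) \<or> (\<forall>j\<in>B. y j < 0)" and t: "triangle S x1 x2 x3"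
  shows "\<exists>j\<in>insert n B. (x1, x2, x3) \<in> {(s, j, r), (j, r, s), (r, s, j)}"
proof -
  define b where "b \<longleftrightarrow> (\<forall>j\<in>B. y j > 0)"
  have yb: "j \<in> B \<Longrightarrow> b \<and> y j > 0 \<or> \<not> b \<and> y j < 0" for j
    using assms(3) D(2) unfolding b_def by force
  define \<phi> where "\<phi> x = (if x = s then 0 else if x = r then n + 2 else if x = n then if b then 1 else n + 1 else x)" for x
  have "\<phi> x < \<phi> z \<or> x \<in> {r} \<and> z = s" if S: "S x z > 0" for x z
    using arrow_ends[OF S]
    by (elim disjE; insert S assms(1,2) a B_facts pos[of x] pos[of z] yb[of x] yb[of z] block[of x z])
       (auto simp: D \<phi>_def)
  from triangle_by_rank[OF this t] obtain j where "S s j > 0" "S j r > 0"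
    "(x1, x2, x3) \<in> {(s, j, r), (j, r, s), (r, s, j)}" by blast
  moreover have "j \<in> insert n B"
    using arrow_ends(2)[OF \<open>S s j > 0\<close>] \<open>S s j > 0\<close> \<open>S j r > 0\<close> D(10) by auto
  ultimately show ?thesis by blast
qed

text \<open>Here \<open>n\<close> is a source or a sink, hence on no oriented triangle, and gets the
  lowest or the highest rank.\<close>

lemma triangles_uniform:
  assumes "u > 0 \<and> v > 0 \<and> (\<forall>j\<in>B. y j > 0) \<or> u < 0 \<and> v < 0 \<and> (\<forall>j\<in>B. y j < 0)"
    and t: "triangle S x1 x2 x3"
  shows "\<exists>j\<in>B. (x1, x2, x3) \<in> {(s, j, r), (j, r, s), (r, s, j)}"
proof -
  define b where "b \<longleftrightarrow> u > 0"
  have yb: "j \<in> B \<Longrightarrow> b \<and> y j > 0 \<or> \<not> b \<and> y j < 0" for j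
    using assms(1) unfolding b_def by force
  have uvb: "b \<and> u > 0 \<and> v > 0 \<or> \<not> b \<and> u < 0 \<and> v < 0"
    using assms(1) unfolding b_def by auto
  define \<phi> where "\<phi> x = (if x = s then 1 else if x = r then n + 2 else if x = n then if b then 0 else n + 3 else x)" for x
  have "\<phi> x < \<phi> z \<or> x \<in> {r} \<and> z = s" if S: "S x z > 0" for x z
    using arrow_ends[OF S]
    by (elim disjE; insert S uvb a B_facts pos[of x] pos[of z] yb[of x] yb[of z] block[of x z])
       (auto simp: D \<phi>_def)
  from triangle_by_rank[OF this t] obtain j where j: "S s j > 0" "S j r > 0"
    "(x1, x2, x3) \<in> {(s, j, r), (j, r, s), (r, s, j)}" by blast
  moreover have "j \<in> B"
    using arrow_ends(2)[OF j(1)] j(1,2) uvb by (auto simp: D)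
  ultimately show ?thesis by blast
qed

text \<open>Here j -> n -> s for all block vertices j. Both r -> s and n -> s go down in rank, so
  there is a second family s -> j -> n -> s.\<close>

lemma triangles_start:
  assumes "u > 0" "v \<noteq> 0" "\<forall>j\<in>B. y j < 0" and t: "triangle S x1 x2 x3"
  shows "\<exists>j\<in>B. \<exists>z\<in>{r, n}. (x1, x2, x3) \<in> {(s, j, z), (j, z, s), (z, s, j)}"
proof -
  define \<phi> where "\<phi> x = (if x = s then 0 else if x = r then n + 2 else if x = n then if v > 0 then n + 1 else n + 3 else x)" for x
  have "\<phi> x < \<phi> z \<or> x \<in> {r, n} \<and> z = s" if S: "S x z > 0" for x z
    using arrow_ends[OF S]
    by (elim disjE; insert S assms(1-3) a B_facts pos[of x] pos[of z] block[of x z])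
       (auto simp: D \<phi>_def dest: bspec)
  from triangle_by_rank[OF this t] obtain j z where j: "z \<in> {r, n}" "S s j > 0" "S j z > 0"
    "(x1, x2, x3) \<in> {(s, j, z), (j, z, s), (z, s, j)}" by blast
  moreover have "j \<in> B"
    using arrow_ends(2)[OF j(2)] j(1-3) assms(1) a by (auto simp: D)
  ultimately show ?thesis by blast
qed

text \<open>The additional triangle s -> n -> r -> s has its heaviest arrow n -> r opposite
  \<open>s\<close>, the others have theirs opposite \<open>r\<close>; mutation at \<open>s\<close>
  or \<open>r\<close> may lower these. Any other vertex has no arrow from \<open>r\<close> and none
  to \<open>s\<close>, so it is no common target or source of a triangle.\<close>

lemma fork_mixed:
  assumes uv: "- u \<ge> 2" "v > - u" "v > a" and y: "(\<forall>j\<in>B. y j > 0) \<or> (\<forall>j\<in>B. y j < 0)"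
    and w: "w \<in> {1..n}" "w \<noteq> s" "w \<noteq> r"
  shows "weak_fork n w (mutate w S)"
proof (rule weak_fork_mutate_by_triangles[OF abundant_stage w(1),
    where P = "\<lambda>x1 x2 x3. x1 = s \<and> x2 \<in> insert n B \<and> x3 = r"])
  have wB: "w \<in> insert n B" using described_vertex[OF desc w(1)] w by auto
  fix x1 x2 x3 assume t: "triangle S x1 x2 x3"
  show "(x1 = s \<and> x2 \<in> insert n B \<and> x3 = r) \<or> (x2 = s \<and> x3 \<in> insert n B \<and> x1 = r) \<or>
      (x3 = s \<and> x1 \<in> insert n B \<and> x2 = r)"
    using triangles_mixed[OF _ _ y t] uv by auto
  assume P: "x1 = s \<and> x2 \<in> insert n B \<and> x3 = r"
  have "\<not> S r w > 0" "\<not> S w s > 0"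
    using wB pos[of w] uv by (auto simp: D)
  then show "\<not> (S x1 w > 0 \<and> S x2 w > 0 \<and> S x3 w > 0) \<and> \<not> (S w x1 > 0 \<and> S w x2 > 0 \<and> S w x3 > 0)"
    using P by blast
  have "S s x2 * S x2 r - S r s > S s x2 \<and> S s x2 * S x2 r - S r s > S x2 r"
  proof (cases "x2 = n")
    case True
    then show ?thesis
      using fork_weights[OF uv(1,3,2)] by (simp add: D mult.commute)
  next
    case False
    then show ?thesis
      using P weights[of x2] by (simp add: D)
  qed
  then show "(w = x2 \<longrightarrow> S x1 x2 * S x2 x3 - S x3 x1 > S x1 x2 \<and> S x1 x2 * S x2 x3 - S x3 x1 > S x2 x3) \<and>
      (w = x1 \<longrightarrow> S x3 x1 * S x1 x2 - S x2 x3 > S x3 x1 \<and> S x3 x1 * S x1 x2 - S x2 x3 > S x1 x2) \<and>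
      (w = x3 \<longrightarrow> S x2 x3 * S x3 x1 - S x1 x2 > S x2 x3 \<and> S x2 x3 * S x3 x1 - S x1 x2 > S x3 x1)"
    using P w by auto
qed

text \<open>The heaviest arrow s -> j of each oriented triangle ends at \<open>s\<close>, so here
  mutation at \<open>s\<close> is admissible too. The vertex \<open>n\<close> is not: the triangles
  lie wholly among its neighbours on one side.\<close>

lemma fork_uniform:
  assumes uvy: "u > 0 \<and> v > 0 \<and> (\<forall>j\<in>B. y j > 0) \<or> u < 0 \<and> v < 0 \<and> (\<forall>j\<in>B. y j < 0)"
    and w: "w \<in> {1..n}" "w \<noteq> r" "w \<noteq> n"
  shows "weak_fork n w (mutate w S)"
proof (rule weak_fork_mutate_by_triangles[OF abundant_stage w(1),
    where P = "\<lambda>x1 x2 x3. x1 = s \<and> x2 \<in> B \<and> x3 = r"])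
  have wB: "w = s \<or> w \<in> B" using described_vertex[OF desc w(1)] w by auto
  fix x1 x2 x3 assume t: "triangle S x1 x2 x3"
  show "(x1 = s \<and> x2 \<in> B \<and> x3 = r) \<or> (x2 = s \<and> x3 \<in> B \<and> x1 = r) \<or>
      (x3 = s \<and> x1 \<in> B \<and> x2 = r)"
    using triangles_uniform[OF uvy t] by auto
  assume P: "x1 = s \<and> x2 \<in> B \<and> x3 = r"
  show "\<not> (S x1 w > 0 \<and> S x2 w > 0 \<and> S x3 w > 0) \<and> \<not> (S w x1 > 0 \<and> S w x2 > 0 \<and> S w x3 > 0)"
    if "w \<notin> {x1, x2, x3}"
  proof -
    have "\<not> S r w > 0" "\<not> S w s > 0"
      using wB pos[of w] that P by (auto simp: D)
    then show ?thesis using P by blast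
  qed
  have "a * p x2 - q x2 > a \<and> a * p x2 - q x2 > p x2"
  proof -
    have "p x2 > q x2" "p x2 > a" "p x2 \<ge> 2" using pq[of x2] P by auto
    then show ?thesis using mult_ge_twice[OF a, of "p x2"] by linarith
  qed
  then show "(w = x2 \<longrightarrow> S x1 x2 * S x2 x3 - S x3 x1 > S x1 x2 \<and> S x1 x2 * S x2 x3 - S x3 x1 > S x2 x3) \<and>
      (w = x1 \<longrightarrow> S x3 x1 * S x1 x2 - S x2 x3 > S x3 x1 \<and> S x3 x1 * S x1 x2 - S x2 x3 > S x1 x2) \<and>
      (w = x3 \<longrightarrow> S x2 x3 * S x3 x1 - S x1 x2 > S x2 x3 \<and> S x2 x3 * S x3 x1 - S x1 x2 > S x3 x1)"
    using P w weights[of x2] by (auto simp: D)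
qed

text \<open>The heaviest arrow is j -> n in s -> j -> n -> s and s -> j in s -> j -> r -> s, so
  mutation at j or \<open>n\<close> raises the opposite weight in either.\<close>

lemma fork_start:
  assumes u: "u \<ge> 2" and y: "\<And>j. j \<in> B \<Longrightarrow> - y j > p j" "\<And>j. j \<in> B \<Longrightarrow> - y j > u"
    and w: "w \<in> {1..n}" "w \<noteq> s" "w \<noteq> r"
  shows "weak_fork n w (mutate w S)"
proof (rule weak_fork_mutate_by_triangles[OF abundant_stage w(1),
    where P = "\<lambda>x1 x2 x3. x1 = s \<and> x2 \<in> B \<and> x3 \<in> {r, n}"])
  have wB: "w \<in> insert n B" using described_vertex[OF desc w(1)] w by auto
  have y0: "\<forall>j\<in>B. y j < 0" using y(2) u by force
  have v: "v \<noteq> 0" using uvy by auto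
  fix x1 x2 x3 assume t: "triangle S x1 x2 x3"
  show "(x1 = s \<and> x2 \<in> B \<and> x3 \<in> {r, n}) \<or> (x2 = s \<and> x3 \<in> B \<and> x1 \<in> {r, n}) \<or>
      (x3 = s \<and> x1 \<in> B \<and> x2 \<in> {r, n})"
    using triangles_start[OF _ v y0 t] u by auto
  assume P: "x1 = s \<and> x2 \<in> B \<and> x3 \<in> {r, n}"
  show "\<not> (S x1 w > 0 \<and> S x2 w > 0 \<and> S x3 w > 0) \<and> \<not> (S w x1 > 0 \<and> S w x2 > 0 \<and> S w x3 > 0)"
    if "w \<notin> {x1, x2, x3}"
  proof (cases "w = n")
    case True
    have "\<not> S s n > 0" "\<not> S n x2 > 0"
      using bspec[OF y0, of x2] P u by (auto simp: D)
    then show ?thesis using True P by blast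
  next
    case False
    then have "\<not> S r w > 0" "\<not> S n w > 0" "\<not> S w s > 0"
      using wB pos[of w] bspec[OF y0, of w] by (auto simp: D)
    then show ?thesis using P by blast
  qed
  have pY: "p x2 \<ge> 2" "- y x2 \<ge> 2" "- y x2 > p x2" "- y x2 > u"
    using pq[of x2] y[of x2] u P by auto
  have "p x2 * (- y x2) - u > p x2 \<and> p x2 * (- y x2) - u > - y x2"
    "(- y x2) * u - p x2 > - y x2 \<and> (- y x2) * u - p x2 > u"
    using mult_ge_twice[OF pY(1,2)] mult_ge_twice[OF pY(2) u] pY by linarith+
  then show "(w = x2 \<longrightarrow> S x1 x2 * S x2 x3 - S x3 x1 > S x1 x2 \<and> S x1 x2 * S x2 x3 - S x3 x1 > S x2 x3) \<and>
      (w = x1 \<longrightarrow> S x3 x1 * S x1 x2 - S x2 x3 > S x3 x1 \<and> S x3 x1 * S x1 x2 - S x2 x3 > S x1 x2) \<and>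
      (w = x3 \<longrightarrow> S x2 x3 * S x3 x1 - S x1 x2 > S x2 x3 \<and> S x2 x3 * S x3 x1 - S x1 x2 > S x3 x1)"
    using P w weights[of x2] by (auto simp: D)
qed

end

section \<open>Sources and sinks as an invariant of the class\<close>

definition no_extremal_vertex :: "nat \<Rightarrow> quiver \<Rightarrow> bool" where
  "no_extremal_vertex n P \<longleftrightarrow> (\<forall>i\<in>{1..n}. (\<exists>j. P i j > 0) \<and> (\<exists>j. P i j < 0))"

lemma no_extremal_vertex_similar:
  assumes "similar_quivers n P P'" "no_extremal_vertex n P"
  shows "no_extremal_vertex n P'"
proof -
  obtain \<sigma> \<epsilon> where *: "\<sigma> permutes {1..n}" "\<epsilon> = 1 \<or> \<epsilon> = - 1" "P' = (\<lambda>i j. \<epsilon> * P (\<sigma> i) (\<sigma> j))"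
    using assms(1) unfolding similar_quivers_def by blast
  show ?thesis
    unfolding no_extremal_vertex_def
  proof
    fix i assume "i \<in> {1..n}"
    then have "\<sigma> i \<in> {1..n}" using permutes_in_image[OF *(1)] by blast
    then obtain x y where "P (\<sigma> i) x > 0" "P (\<sigma> i) y < 0"
      using assms(2) unfolding no_extremal_vertex_def by blast
    then have "P (\<sigma> i) (\<sigma> (inv \<sigma> x)) > 0" "P (\<sigma> i) (\<sigma> (inv \<sigma> y)) < 0"
      using permutes_inverses(1)[OF *(1)] by simp_all
    then show "(\<exists>j. P' i j > 0) \<and> (\<exists>j. P' i j < 0)"
      using *(2) unfolding *(3) by force
  qed
qed

lemma no_extremal_vertexI:
  assumes S: "described n W S s r \<alpha> p q u v y"
    and "\<exists>x. S s x > 0" "\<exists>x. S s x < 0" "\<exists>x. S r x > 0" "\<exists>x. S r x < 0" "\<exists>x. S n x > 0" "\<exists>x. S n x < 0"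
    and "\<And>j. j \<in> {3..<n} \<Longrightarrow> \<exists>x. S j x > 0" "\<And>j. j \<in> {3..<n} \<Longrightarrow> \<exists>x. S j x < 0"
  shows "no_extremal_vertex n S"
  unfolding no_extremal_vertex_def
proof
  fix i assume "i \<in> {1..n}"
  from described_vertex[OF S this] show "(\<exists>j. S i j > 0) \<and> (\<exists>j. S i j < 0)"
    using assms(2-9) by blast
qed

lemma sink_mutate:
  assumes "quiver_on n P" "\<And>x. P l x \<le> 0"
  shows "mutate l P i j = (if l = i \<or> l = j then - P i j else P i j)"
proof -
  have "mut_term (P i l) (P l j) = 0"
    using assms(2)[of i] assms(2)[of j] quiver_on_skew[OF assms(1), of i l] by (auto simp: mut_term_def)
  then show ?thesis by (simp add: mutate_eq)
qed

lemma described_mutate_sink: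
  assumes S: "described n W S s r \<alpha> p q u v y" and sink: "\<And>x. S n x \<le> 0"
  shows "described n W (mutate n S) s r \<alpha> p q (- u) (- v) (\<lambda>j. - y j)"
proof -
  note eq = sink_mutate[OF describedD(1)[OF S] sink]
  have ne: "n \<noteq> s" "n \<noteq> r" "j \<in> {3..<n} \<Longrightarrow> n \<noteq> j" for j
    using describedD(2,3)[OF S] by auto
  have "mutate n S s r = \<alpha>" "mutate n S n s = - u" "mutate n S n r = - v"
    using ne by (simp_all add: eq describedD(4-17)[OF S])
  moreover have "mutate n S s j = p j" "mutate n S r j = q j" "mutate n S n j = - y j" if "j \<in> {3..<n}" for j
    using ne(1,2) ne(3)[OF that] that by (simp_all only: eq describedD(4-17)[OF S] if_False if_True simp_thms)
  moreover have "mutate n S i j = W i j" if "i \<in> {3..<n}" "j \<in> {3..<n}" for i j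
    using ne(3)[OF that(1)] ne(3)[OF that(2)] that
    by (simp_all only: eq describedD(4-17)[OF S] if_False simp_thms)
  ultimately show ?thesis
    using describedD(2,3)[OF S] quiver_on_mutate[OF describedD(1)[OF S]] unfolding described_def by blast
qed

lemma mut_term_signs:
  "x > 0 \<Longrightarrow> y > 0 \<Longrightarrow> mut_term x y = x * y"
  "x > 0 \<Longrightarrow> y > 0 \<Longrightarrow> mut_term (- x) (- y) = - (x * y)"
  "x > 0 \<Longrightarrow> y > 0 \<Longrightarrow> mut_term (- x) y = 0"
  "x > 0 \<Longrightarrow> y > 0 \<Longrightarrow> mut_term x (- y) = 0"
  by (auto simp: mut_term_def)

section \<open>Mutation words and the quivers they visit\<close>

definition alternating :: "nat \<Rightarrow> nat \<Rightarrow> nat \<Rightarrow> nat list" where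
  "alternating x y m = map (\<lambda>i. if even i then x else y) [0..<m]"

lemma alternating_0 [simp]: "alternating x y 0 = []"
  and alternating_Suc [simp]: "alternating x y (Suc m) = alternating x y m @ [if even m then x else y]"
  and length_alternating [simp]: "length (alternating x y m) = m"
  by (simp_all add: alternating_def)

lemma take_alternating: "t \<le> m \<Longrightarrow> take t (alternating x y m) = alternating x y t"
  by (simp add: alternating_def take_map)

lemma concat_replicate_alternating:
  fixes x y :: nat
  shows "concat (replicate k [x, y]) = alternating x y (2 * k)"
proof (induction k)
  case (Suc k)
  have "replicate (Suc k) [x, y] = replicate k [x, y] @ [[x, y]]"
    by (simp add: replicate_append_same)
  then show ?case by (simp only: concat_append Suc.IH) simp
qed simp

lemma rev_alternating: "rev (alternating x y (2 * k)) = alternating y x (2 * k)"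
proof -
  have "rev (concat (replicate k [x, y])) = concat (replicate k [y, x])"
    by (simp add: rev_concat)
  then show ?thesis by (simp only: concat_replicate_alternating)
qed

lemma mutate_seq_take_rev:
  assumes "quiver_on n P" "m \<le> length xs"
  shows "mutate_seq (take m (rev xs)) (mutate_seq xs P) = mutate_seq (take (length xs - m) xs) P"
proof -
  define l where "l = length xs - m"
  have "mutate_seq xs P = mutate_seq (drop l xs) (mutate_seq (take l xs) P)"
    by (metis append_take_drop_id mutate_seq_append)
  moreover have "take m (rev xs) = rev (drop l xs)"
    using assms(2) by (simp add: l_def take_rev)
  ultimately show ?thesis
    using mutate_seq_rev[OF quiver_on_mutate_seq[OF assms(1)]] by (simp add: l_def)
qed

lemma mutation_path_Cons: "mutation_path (k # ks) Q = Q # mutation_path ks (mutate k Q)"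
  unfolding mutation_path_def
  by (simp add: upt_conv_Cons map_Suc_upt[symmetric] del: upt_Suc)

lemma mutation_path_Nil: "mutation_path [] Q = []"
  by (simp add: mutation_path_def)

lemma mutation_path_append: "mutation_path (xs @ ys) Q = mutation_path xs Q @ mutation_path ys (mutate_seq xs Q)"
  by (induction xs arbitrary: Q) (simp_all add: mutation_path_Cons mutation_path_Nil)

lemma in_mutation_path: "P \<in> set (mutation_path xs Q) \<longleftrightarrow> (\<exists>m<length xs. P = mutate_seq (take m xs) Q)"
  by (auto simp: mutation_path_def)

section \<open>The long mutation cycle\<close>

locale long_cycle =
  fixes n k :: nat and Rt Q :: quiver
  assumes n: "n \<ge> 4" and k: "k \<ge> 1"
    and Rt: "quiver_on (n - 1) Rt"
    and Rt_ge: "\<And>i j. i \<in> {1..n-1} \<Longrightarrow> j \<in> {1..n-1} \<Longrightarrow> i < j \<Longrightarrow> Rt i j \<ge> 2"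
    and Q: "quiver_on n Q"
    and Q_sub: "full_subquiver {1..n-1} Q = mutate_seq (concat (replicate k [2, 1])) Rt"
    and Q_n: "\<And>i. i \<in> {1..n-1} \<Longrightarrow> Q i n \<ge> 2"
begin

abbreviation "J \<equiv> {3..<n}"

definition a :: int where "a = Rt 1 2"

text \<open>The entries between j and the vertices 1, 2. The negative value at index 0 records that
  \<open>Rt\<close> is acyclic; in \<open>Q\<close> there are \<open>C j (2 * k)\<close> arrows j ->
  1 and \<open>C j (Suc (2 * k))\<close> arrows 2 -> j.\<close>

definition C :: "nat \<Rightarrow> nat \<Rightarrow> int" where "C j m = rec2 a (- Rt 1 j) (Rt 2 j) m"

text \<open>The entries between \<open>n\<close> and the vertices 1, 2. They agree in
  \<open>S (Suc t)\<close> and \<open>T (Suc (Suc t))\<close>: the mutation at \<open>n\<close>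
  reverses both arrows at once, the first two mutations of \<open>T\<close> one at a time.\<close>

definition D :: "nat \<Rightarrow> int" where "D t = rec2 a (- Q 2 n) (Q 1 n) t"

text \<open>The number of arrows j -> n from the second step of \<open>T\<close> on: the first two
  mutations add the paths j -> 1 -> n and j -> 2 -> n, later ones add nothing.\<close>

definition Y :: "nat \<Rightarrow> int" where "Y j = Q j n + Q 1 n * C j (2 * k) + Q 2 n * C j (2 * k - 1)"

definition alt :: "nat \<Rightarrow> nat" where "alt t = (if even t then 1 else 2)"

definition T :: "nat \<Rightarrow> quiver" where "T t = mutate_seq (alternating 1 2 t) Q"

definition S :: "nat \<Rightarrow> quiver" where
  "S t = (case t of 0 \<Rightarrow> Q | Suc t \<Rightarrow> mutate_seq (alternating 1 2 t) (mutate n Q))"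

lemma a: "a \<ge> 2" using Rt_ge[of 1 2] n by (simp add: a_def)

lemma Rt_B: "j \<in> J \<Longrightarrow> Rt 1 j \<ge> 2" "j \<in> J \<Longrightarrow> Rt 2 j \<ge> 2" "i \<in> J \<Longrightarrow> j \<in> J \<Longrightarrow> i < j \<Longrightarrow> Rt i j \<ge> 2"
  using n by (auto intro!: Rt_ge)

lemma three: "3 \<in> J" using n by simp

lemma Qn: "Q 1 n \<ge> 2" "Q 2 n \<ge> 2" "j \<in> J \<Longrightarrow> Q j n \<ge> 2"
  using n by (auto intro!: Q_n)

lemma C_0: "C j 0 = - Rt 1 j" and C_1: "C j (Suc 0) = Rt 2 j"
  and C_rec: "C j (Suc (Suc m)) = a * C j (Suc m) - C j m"
  by (simp_all add: C_def)

lemma D_0: "D 0 = - Q 2 n" and D_1: "D (Suc 0) = Q 1 n"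
  and D_rec: "D (Suc (Suc m)) = a * D (Suc m) - D m"
  by (simp_all add: D_def)

lemma C_ge: "j \<in> J \<Longrightarrow> C j (Suc m) \<ge> 2" and C_mono: "j \<in> J \<Longrightarrow> C j (Suc (Suc m)) > C j (Suc m)"
  and C_gt_a: "j \<in> J \<Longrightarrow> C j (Suc (Suc m)) > a"
  unfolding C_def using rec2_mono[of a "- Rt 1 j" "Rt 2 j" m] rec2_gt_coeff[of a "- Rt 1 j" "Rt 2 j" m] a Rt_B[of j]
  by auto

lemma D_ge: "D (Suc m) \<ge> 2" and D_mono: "D (Suc (Suc m)) > D (Suc m)"
  and D_gt_a: "D (Suc (Suc m)) > a"
  unfolding D_def using rec2_mono[of a "- Q 2 n" "Q 1 n" m] rec2_gt_coeff[of a "- Q 2 n" "Q 1 n" m] a Qn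
  by auto

lemma C_pos: "j \<in> J \<Longrightarrow> C j (Suc m) > 0" using C_ge[of j m] by simp

lemma D_pos: "D (Suc m) > 0" using D_ge[of m] by simp

text \<open>Computed from \<open>Q\<close> the entry involves \<open>C\<close>, computed from
  \<open>R\<close> it involves \<open>D\<close>.\<close>

lemma Y_eq: "Y j = Q j n + Rt 2 j * D (2 * k) + Rt 1 j * D (2 * k - 1)"
proof -
  obtain m where m: "2 * k = Suc m" using k by (cases "2 * k") auto
  then have m': "2 * k - 1 = m" by simp
  show ?thesis
    unfolding Y_def C_def D_def m' unfolding m
    using rec2_wronskian[of "Q 1 n" a "- Rt 1 j" "Rt 2 j" m "- Q 2 n"]
    by (simp add: algebra_simps)
qed

lemma a_pos: "a > 0" using a by simp

lemma Qn_pos: "Q 1 n > 0" "Q 2 n > 0" using Qn by auto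

section \<open>Entries along the mutations at 1 and 2\<close>

text \<open>The passage from \<open>Rt\<close> to \<open>Q\<close> with \<open>n\<close> as an
  isolated vertex; each mutation raises the index of \<open>C\<close>.\<close>

lemma described_forward:
  "described n Rt (mutate_seq (alternating 2 1 t) Rt) (alt t) (alt (Suc t)) a (\<lambda>j. - C j t) (\<lambda>j. C j (Suc t)) 0 0 (\<lambda>_. 0)"
proof (induction t)
  case 0
  have "Rt i j = 0" if "i \<notin> {1..n} \<or> j \<notin> {1..n}" for i j
    by (rule ccontr) (use quiver_on_outside[OF Rt, of i j] that in auto)
  then have "quiver_on n Rt"
    using quiver_on_skew[OF Rt] unfolding quiver_on_def by blast
  moreover have "Rt n i = 0" for i
    by (rule ccontr) (use quiver_on_outside[OF Rt, of n i] n in auto)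
  ultimately show ?case
    using n by (simp add: described_def alt_def a_def C_0 C_1)
next
  case (Suc t)
  have "described n Rt (mutate (alt (Suc t)) (mutate_seq (alternating 2 1 t) Rt)) (alt (Suc t)) (alt t) a
      (\<lambda>j. - C j (Suc t)) (\<lambda>j. - C j t + mut_term a (C j (Suc t))) (- 0) (0 + mut_term 0 (- a))
      (\<lambda>j. 0 + mut_term 0 (C j (Suc t)))"
    by (rule described_mutate[OF Suc]) (use C_pos in blast)
  then have "described n Rt (mutate (alt (Suc t)) (mutate_seq (alternating 2 1 t) Rt)) (alt (Suc t)) (alt t) a
      (\<lambda>j. - C j (Suc t)) (\<lambda>j. C j (Suc (Suc t))) 0 0 (\<lambda>_. 0)"
    by (rule described_cong) (simp_all add: mut_term_signs a_pos C_pos C_rec)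
  moreover have "mutate_seq (alternating 2 1 (Suc t)) Rt = mutate (alt (Suc t)) (mutate_seq (alternating 2 1 t) Rt)"
    "alt (Suc (Suc t)) = alt t"
    by (simp_all add: alt_def)
  ultimately show ?case by (simp only:)
qed

lemma described_Q:
  "described n Rt Q 2 1 (- a) (\<lambda>j. C j (Suc (2 * k))) (\<lambda>j. - C j (2 * k)) (- Q 2 n) (- Q 1 n) (\<lambda>j. - Q j n)"
proof -
  define F where "F = mutate_seq (alternating 2 1 (2 * k)) Rt"
  have F: "described n Rt F 1 2 a (\<lambda>j. - C j (2 * k)) (\<lambda>j. C j (Suc (2 * k))) 0 0 (\<lambda>_. 0)"
    using described_forward[of "2 * k"] by (simp add: F_def alt_def)
  have eq: "Q i j = F i j" if "i \<in> {1..n-1}" "j \<in> {1..n-1}" for i j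
    using fun_cong[OF fun_cong[OF Q_sub, of i], of j] that
    by (simp add: full_subquiver_def F_def concat_replicate_alternating)
  have "Q n i = - Q i n" for i using Q by (rule quiver_on_skew)
  moreover have "Q 2 1 = - a"
    using eq[of 2 1] describedD(5)[OF F] n by simp
  moreover have "Q 2 j = C j (Suc (2 * k))" "Q 1 j = - C j (2 * k)" if "j \<in> J" for j
    using eq[of 2 j] eq[of 1 j] describedD(11,13)[OF F that] that by auto
  moreover have "Q i j = Rt i j" if "i \<in> J" "j \<in> J" for i j
    using eq[of i j] describedD(17)[OF F that] that by auto
  ultimately show ?thesis
    unfolding described_def using n Q by (simp del: One_nat_def)
qed

text \<open>The paths through \<open>r\<close> are n -> r -> s and j -> r -> s: the first raise the
  index of \<open>D\<close>, the second lower that of \<open>C\<close>. The entries between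
  \<open>n\<close> and j persist because both vertices point to \<open>r\<close>.\<close>

lemma stage_step:
  assumes "described n Rt P s r (- a) (\<lambda>j. C j (Suc (Suc m))) (\<lambda>j. - C j (Suc m)) (- D t) (D (Suc t)) y"
  shows "described n Rt (mutate r P) r s (- a) (\<lambda>j. C j (Suc m)) (\<lambda>j. - C j m) (- D (Suc t)) (D (Suc (Suc t))) y"
proof -
  have neg: "\<forall>j\<in>J. - C j (Suc m) < 0" using C_pos by simp
  then have "described n Rt (mutate r P) r s (- a) (\<lambda>j. - (- C j (Suc m)))
      (\<lambda>j. C j (Suc (Suc m)) + mut_term (- a) (- C j (Suc m))) (- D (Suc t))
      (- D t + mut_term (D (Suc t)) (- (- a))) (\<lambda>j. y j + mut_term (D (Suc t)) (- C j (Suc m)))"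
    by (intro described_mutate[OF assms]) blast
  then show ?thesis
    by (rule described_cong)
       (simp_all add: mut_term_signs a_pos C_pos D_pos C_rec D_rec mult.commute)
qed

lemma Q_sink: "Q n x \<le> 0"
proof (cases "x \<in> {1..n-1}")
  case True
  then show ?thesis using Q_n[OF True] quiver_on_skew[OF Q, of n x] by linarith
next
  case False
  then have "x = n \<or> x \<notin> {1..n}" by auto
  then show ?thesis
    using describedD(10)[OF described_Q, of n] quiver_on_outside[OF Q, of n x] by force
qed

lemma mutate_n_Q: "mutate n Q i j = (if n = i \<or> n = j then - Q i j else Q i j)"
  by (rule sink_mutate[OF Q Q_sink])

lemma T_Suc: "T (Suc t) = mutate (alt t) (T t)"
  by (simp add: T_def alt_def)

lemma S_Suc: "S (Suc (Suc t)) = mutate (alt t) (S (Suc t))"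
  by (simp add: S_def alt_def)

lemma T_0: "T 0 = Q" and S_0: "S 0 = Q" and S_1: "S (Suc 0) = mutate n Q"
  by (simp_all add: S_def T_def)

lemma described_S:
  assumes "t + m = 2 * k"
  shows "described n Rt (S (Suc t)) (alt (Suc t)) (alt t) (- a) (\<lambda>j. C j (Suc m)) (\<lambda>j. - C j m)
     (- D t) (D (Suc t)) (\<lambda>j. Q j n)"
  using assms
proof (induction t arbitrary: m)
  case 0
  have alt: "alt (Suc 0) = 2" "alt 0 = 1" by (simp_all add: alt_def)
  have m: "m = 2 * k" using 0 by simp
  show ?case
    unfolding S_1 alt D_0 D_1 m
    by (rule described_cong[OF described_mutate_sink[OF described_Q Q_sink]]) simp_all
next
  case (Suc t)
  have "alt (Suc (Suc t)) = alt t" by (simp add: alt_def)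
  moreover have "t + Suc m = 2 * k" using Suc.prems by simp
  ultimately show ?case using stage_step[OF Suc.IH] unfolding S_Suc by metis
qed

text \<open>The first two steps of \<open>T\<close> fall outside \<open>stage_step\<close>: the
  mutated vertex still points to \<open>n\<close>, so paths from the block to \<open>n\<close> arise
  and the arrow at \<open>n\<close> is merely reversed.\<close>

lemma described_T1:
  "described n Rt (T (Suc 0)) 1 2 (- a) (\<lambda>j. C j (2 * k)) (\<lambda>j. - C j (2 * k - 1)) (Q 1 n) (- Q 2 n)
    (\<lambda>j. - Q j n - Q 1 n * C j (2 * k))"
proof -
  obtain m where m: "2 * k = Suc m" using k by (cases "2 * k") auto
  then have m': "2 * k - 1 = m" by simp
  have "\<forall>j\<in>J. - C j (2 * k) < 0" using C_pos m by simp
  then have *: "described n Rt (mutate 1 Q) 1 2 (- a) (\<lambda>j. - (- C j (2 * k)))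
      (\<lambda>j. C j (Suc (2 * k)) + mut_term (- a) (- C j (2 * k))) (- (- Q 1 n)) (- Q 2 n + mut_term (- Q 1 n) (- (- a)))
      (\<lambda>j. - Q j n + mut_term (- Q 1 n) (- C j (2 * k)))"
    by (intro described_mutate[OF described_Q]) blast
  have T1: "T (Suc 0) = mutate 1 Q" by (simp add: T_Suc T_0 alt_def)
  show ?thesis
    unfolding T1 m' unfolding m
    by (rule described_cong[OF *[unfolded m]])
       (simp_all add: mut_term_signs a_pos Qn_pos C_pos C_rec del: One_nat_def)
qed

lemma described_T2:
  "described n Rt (T (Suc (Suc 0))) 2 1 (- a) (\<lambda>j. C j (2 * k - 1)) (\<lambda>j. - C j (2 * k - 2)) (Q 2 n) (Q 1 n) (\<lambda>j. - Y j)"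
proof -
  obtain m where m: "2 * k = Suc (Suc m)" using k by (cases "2 * k"; cases "2 * k - 1") auto
  then have m': "2 * k - 1 = Suc m" "2 * k - 2 = m" by auto
  have "\<forall>j\<in>J. - C j (2 * k - 1) < 0" using C_pos m by simp
  then have *: "described n Rt (mutate 2 (T (Suc 0))) 2 1 (- a) (\<lambda>j. - (- C j (2 * k - 1)))
      (\<lambda>j. C j (2 * k) + mut_term (- a) (- C j (2 * k - 1))) (- (- Q 2 n)) (Q 1 n + mut_term (- Q 2 n) (- (- a)))
      (\<lambda>j. - Q j n - Q 1 n * C j (2 * k) + mut_term (- Q 2 n) (- C j (2 * k - 1)))"
    by (intro described_mutate[OF described_T1]) blast
  have T2: "T (Suc (Suc 0)) = mutate 2 (T (Suc 0))" by (simp add: T_Suc[of "Suc 0"] alt_def)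
  show ?thesis
    unfolding T2 Y_def m' unfolding m
    by (rule described_cong[OF *[unfolded m' , unfolded m]])
       (simp_all add: mut_term_signs a_pos Qn_pos C_pos C_rec del: One_nat_def)
qed

lemma described_T:
  assumes "t + m + 2 = 2 * k"
  shows "described n Rt (T (Suc (Suc t))) (alt (Suc t)) (alt t) (- a) (\<lambda>j. C j (Suc m)) (\<lambda>j. - C j m)
     (- D t) (D (Suc t)) (\<lambda>j. - Y j)"
  using assms
proof (induction t arbitrary: m)
  case 0
  then have "2 * k - 1 = Suc m" "2 * k - 2 = m" by auto
  then show ?case using described_T2 by (simp add: alt_def D_0 D_1)
next
  case (Suc t)
  have "alt (Suc (Suc t)) = alt t" by (simp add: alt_def)
  moreover have "t + Suc m + 2 = 2 * k" using Suc.prems by simp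
  ultimately show ?case using stage_step[OF Suc.IH] unfolding T_Suc[of "Suc (Suc t)"]
    by (metis T_Suc)
qed

section \<open>From \<open>R\<close> through the mutations at n - 1, ..., 1 to the end of
  \<open>T\<close>\<close>

definition R :: quiver where "R = S (Suc (2 * k))"

text \<open>The quiver obtained from \<open>R\<close> by mutating at \<open>n - 1, \<dots>, l\<close>, each of them a sink at its turn.\<close>

definition N :: "nat \<Rightarrow> quiver" where
  "N l i j = (if (i \<in> {l..<n}) = (j \<in> {l..<n}) then R i j else - R i j)"

text \<open>At index 0 the sign of \<open>C j 0\<close> makes the triangles on 1, 2, j acyclic
  again: without \<open>n\<close> the quiver is \<open>Rt\<close>.\<close>

lemma described_R: "described n Rt R 2 1 (- a) (\<lambda>j. Rt 2 j) (\<lambda>j. Rt 1 j) (- D (2 * k)) (D (Suc (2 * k))) (\<lambda>j. Q j n)"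
  using described_S[of "2 * k" 0] by (simp add: R_def C_0 C_1 alt_def del: One_nat_def)

lemmas R_entries = describedD[OF described_R]

lemma D_2k: "D (2 * k) > a" "D (2 * k) \<ge> 2" "D (Suc (2 * k)) > D (2 * k)" "D (2 * k - 1) \<ge> 2"
proof -
  obtain m where m: "2 * k = Suc (Suc m)" using k by (cases "2 * k"; cases "2 * k - 1") auto
  then have "2 * k - 1 = Suc m" by simp
  then show "D (2 * k) > a" "D (2 * k) \<ge> 2" "D (Suc (2 * k)) > D (2 * k)" "D (2 * k - 1) \<ge> 2"
    using D_gt_a[of m] D_ge[of "Suc m"] D_mono[of "Suc m"] D_ge[of m] by (simp_all only: m)
qed

lemma vertex_cases:
  assumes "x \<in> {1..n}"
  obtains "x = 1" | "x = 2" | "x = n" | "x \<in> J"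
  using assms n by force

lemma quiver_on_R: "quiver_on n R" by (rule R_entries(1))

lemma R_to_B: "x \<notin> J \<Longrightarrow> j \<in> J \<Longrightarrow> R j x \<le> 0"
proof -
  assume x: "x \<notin> J" and j: "j \<in> J"
  show "R j x \<le> 0"
  proof (cases "x \<in> {1..n}")
    case True
    then show ?thesis
      using x R_entries(12,14,16)[OF j] Rt_B(1,2)[OF j] Qn(3)[OF j] by (cases rule: vertex_cases) auto
  next
    case False
    then show ?thesis using quiver_on_outside[OF quiver_on_R, of j x] by force
  qed
qed

lemma R_to_B_less: "x \<in> {1, 2, n} \<Longrightarrow> j \<in> J \<Longrightarrow> R j x < 0"
  using R_entries(12,14,16)[of j] Rt_B(1,2)[of j] Qn(3)[of j] by auto

lemma R_block: "i \<in> J \<Longrightarrow> j \<in> J \<Longrightarrow> i < j \<Longrightarrow> R i j > 0" "i \<in> J \<Longrightarrow> j \<in> J \<Longrightarrow> i < j \<Longrightarrow> R j i < 0"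
proof -
  assume *: "i \<in> J" "j \<in> J" "i < j"
  then show "R i j > 0" using R_entries(17)[OF *(1,2)] Rt_B(3)[OF *] by simp
  then show "R j i < 0" using quiver_on_skew[OF quiver_on_R, of i j] by simp
qed

lemma quiver_on_N: "quiver_on n (N l)"
  unfolding quiver_on_def
proof (intro conjI allI impI)
  show "N l i j = - N l j i" for i j
    using quiver_on_skew[OF quiver_on_R, of i j]
    by (cases "i \<in> {l..<n}"; cases "j \<in> {l..<n}") (simp_all add: N_def del: atLeastLessThan_iff)
  show "N l i j = 0" if "i \<notin> {1..n} \<or> j \<notin> {1..n}" for i j
    using quiver_on_outside[OF quiver_on_R, of i j] that by (force simp: N_def)
qed

lemma N_n: "N n = R"
  by (simp add: N_def fun_eq_iff)

lemma N_mutate: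
  assumes l: "l \<in> J"
  shows "mutate l (N (Suc l)) = N l"
proof (intro ext)
  fix i j
  have "N (Suc l) l x \<le> 0" for x
  proof (cases "x \<in> J")
    case True
    consider "x < l" | "x = l" | "x > l" by linarith
    then show ?thesis
    proof cases
      case 1
      then show ?thesis using R_block(2)[OF True l 1] by (simp add: N_def)
    next
      case 2
      then show ?thesis using R_entries(10)[of l] by (simp add: N_def)
    next
      case 3
      then show ?thesis using R_block(1)[OF l True 3] True by (simp add: N_def)
    qed
  next
    case False
    then show ?thesis using R_to_B[OF False l] l by (auto simp: N_def)
  qed
  then have "mutate l (N (Suc l)) i j = (if l = i \<or> l = j then - N (Suc l) i j else N (Suc l) i j)"
    by (rule sink_mutate[OF quiver_on_N])
  also have "\<dots> = N l i j"
  proof (cases "i = j")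
    case True
    then show ?thesis using R_entries(10)[of j] by (simp add: N_def)
  next
    case False
    then show ?thesis using l by (auto simp: N_def)
  qed
  finally show "mutate l (N (Suc l)) i j = N l i j" .
qed

lemma N_eq: "3 \<le> l \<Longrightarrow> l \<le> n \<Longrightarrow> mutate_seq (rev [l..<n]) R = N l"
proof (induction "n - l" arbitrary: l)
  case 0
  then have "l = n" by simp
  show ?case unfolding \<open>l = n\<close> by (simp add: N_n)
next
  case (Suc d)
  then have "l < n" by simp
  moreover have "mutate_seq (rev [Suc l..<n]) R = N (Suc l)"
    using Suc by simp
  ultimately show ?case
    using N_mutate[of l] Suc.prems by (simp add: upt_conv_Cons)
qed

lemma described_N3:
  "described n Rt (N 3) 1 2 a (\<lambda>j. - Rt 1 j) (\<lambda>j. - Rt 2 j) (D (Suc (2 * k))) (- D (2 * k)) (\<lambda>j. - Q j n)"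
  unfolding described_def
  using n R_entries(4-17) quiver_on_N by (simp add: N_def del: One_nat_def)

lemma described_N2:
  "described n Rt (mutate 2 (N 3)) 2 1 a (\<lambda>j. Rt 2 j) (\<lambda>j. - Rt 1 j) (D (2 * k)) (- D (2 * k - 1))
     (\<lambda>j. - Q j n - D (2 * k) * Rt 2 j)"
proof -
  obtain m where m: "2 * k = Suc (Suc m)" using k by (cases "2 * k"; cases "2 * k - 1") auto
  then have rec: "D (Suc (2 * k)) = a * D (2 * k) - D (2 * k - 1)" by (simp add: D_rec)
  have pos: "D (2 * k) > 0" unfolding m by (rule D_pos)
  have J: "j \<in> J \<Longrightarrow> Rt 2 j > 0" for j using Rt_B(2)[of j] by simp
  then have "\<forall>j\<in>J. - Rt 2 j < 0" by simp
  then have *: "described n Rt (mutate 2 (N 3)) 2 1 a (\<lambda>j. - (- Rt 2 j)) (\<lambda>j. - Rt 1 j + mut_term a (- Rt 2 j))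
      (- (- D (2 * k))) (D (Suc (2 * k)) + mut_term (- D (2 * k)) (- a)) (\<lambda>j. - Q j n + mut_term (- D (2 * k)) (- Rt 2 j))"
    by (intro described_mutate[OF described_N3]) blast
  show ?thesis
    by (rule described_cong[OF *]) (simp_all add: mut_term_signs a_pos J pos rec)
qed

text \<open>Here the long cycle meets the path \<open>T\<close>: both quivers have the same
  description, for the arrows from the block to \<open>n\<close> by \<open>Y_eq\<close>. The
  remaining word runs back along \<open>T\<close> to \<open>Q\<close>.\<close>

lemma N1_eq_T: "mutate 1 (mutate 2 (N 3)) = T (2 * k)"
proof -
  obtain m where m: "2 * k = Suc (Suc m)" using k by (cases "2 * k"; cases "2 * k - 1") auto
  then have m': "2 * k - 1 = Suc m" by simp
  have J: "j \<in> J \<Longrightarrow> Rt 1 j > 0" for j using Rt_B(1)[of j] by simp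
  then have "\<forall>j\<in>J. - Rt 1 j < 0" by simp
  then have *: "described n Rt (mutate 1 (mutate 2 (N 3))) 1 2 a (\<lambda>j. - (- Rt 1 j)) (\<lambda>j. Rt 2 j + mut_term a (- Rt 1 j))
      (- (- D (2 * k - 1))) (D (2 * k) + mut_term (- D (2 * k - 1)) (- a))
      (\<lambda>j. - Q j n - D (2 * k) * Rt 2 j + mut_term (- D (2 * k - 1)) (- Rt 1 j))"
    by (intro described_mutate[OF described_N2]) blast
  have even: "even m" using m by presburger
  have T: "described n Rt (T (2 * k)) 1 2 a (\<lambda>j. Rt 1 j) (\<lambda>j. Rt 2 j) (D (Suc m)) (- D m) (\<lambda>j. - Y j)"
    using described_swap[OF described_T[of m 0]] m even
    by (simp add: alt_def C_0 C_1 del: One_nat_def)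
  have "described n Rt (mutate 1 (mutate 2 (N 3))) 1 2 a (\<lambda>j. Rt 1 j) (\<lambda>j. Rt 2 j) (D (Suc m)) (- D m) (\<lambda>j. - Y j)"
    unfolding Y_eq m' unfolding m
    by (rule described_cong[OF *[unfolded m', unfolded m]])
       (simp_all add: mut_term_signs a_pos J D_pos D_rec mult.commute del: One_nat_def)
  then show ?thesis using T by (rule described_unique)
qed

lemma N_entries: "l \<in> {3..n} \<Longrightarrow> x \<in> {1, 2, n} \<Longrightarrow> z \<in> {1, 2, n} \<Longrightarrow> N l x z = R x z"
  by (auto simp: N_def)

section \<open>Forks beside the two paths\<close>

lemma stage_cyclic:
  assumes "described n Rt P s r (- a) (\<lambda>j. C j (Suc (Suc m))) (\<lambda>j. - C j (Suc m)) u v y"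
    and "\<bar>u\<bar> \<ge> 2" "\<bar>v\<bar> \<ge> 2" "\<And>j. j \<in> J \<Longrightarrow> \<bar>y j\<bar> \<ge> 2"
  shows "cyclic_stage n Rt P s r a (\<lambda>j. C j (Suc (Suc m))) (\<lambda>j. C j (Suc m)) u v y"
  using assms a Rt_B(3) C_ge C_mono C_gt_a by unfold_locales auto

lemma Y_bounds:
  assumes "j \<in> J"
  shows "Y j > C j (2 * k - 1)" "Y j > Q 2 n" "Y j \<ge> 2"
    "Q j n + Q 1 n * C j (2 * k) > C j (2 * k)" "Q j n + Q 1 n * C j (2 * k) > Q 1 n"
proof -
  obtain m where m: "2 * k = Suc (Suc m)" using k by (cases "2 * k"; cases "2 * k - 1") auto
  then have m': "2 * k - 1 = Suc m" by simp
  have C: "C j (2 * k) \<ge> 2" "C j (2 * k - 1) \<ge> 2" using C_ge[OF assms] m m' by auto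
  have "Q 1 n * C j (2 * k) \<ge> 2 * C j (2 * k)" "Q 1 n * C j (2 * k) \<ge> 2 * Q 1 n"
    "Q 2 n * C j (2 * k - 1) \<ge> 2 * C j (2 * k - 1)" "Q 2 n * C j (2 * k - 1) \<ge> 2 * Q 2 n"
    using mult_ge_twice[OF Qn(1) C(1)] mult_ge_twice[OF Qn(2) C(2)] by auto
  then show "Y j > C j (2 * k - 1)" "Y j > Q 2 n" "Y j \<ge> 2"
    "Q j n + Q 1 n * C j (2 * k) > C j (2 * k)" "Q j n + Q 1 n * C j (2 * k) > Q 1 n"
    using Qn(1,2) Qn(3)[OF assms] C unfolding Y_def by linarith+
qed

lemma Q_abs: "2 \<le> \<bar>Q 1 n\<bar>" "2 \<le> \<bar>Q 2 n\<bar>" "j \<in> J \<Longrightarrow> 2 \<le> \<bar>Q j n\<bar>"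
  using Qn(1,2) Qn(3)[of j] by auto

lemma Q_cyclic:
  obtains m where "2 * k = Suc m" "cyclic_stage n Rt Q 2 1 a (\<lambda>j. C j (Suc (Suc m))) (\<lambda>j. C j (Suc m)) (- Q 2 n) (- Q 1 n) (\<lambda>j. - Q j n)"
proof -
  obtain m where m: "2 * k = Suc m" using k by (cases "2 * k") auto
  show thesis
    by (rule that[OF m], rule stage_cyclic) (use described_Q m Q_abs in \<open>auto simp del: One_nat_def\<close>)
qed

lemma Q_triangle:
  assumes "triangle Q x y z"
  shows "\<exists>j\<in>J. (x, y, z) \<in> {(2, j, 1), (j, 1, 2), (1, 2, j)}"
proof -
  obtain m where "cyclic_stage n Rt Q 2 1 a (\<lambda>j. C j (Suc (Suc m))) (\<lambda>j. C j (Suc m)) (- Q 2 n) (- Q 1 n) (\<lambda>j. - Q j n)"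
    using Q_cyclic by blast
  then interpret cyclic_stage n Rt Q 2 1 a "\<lambda>j. C j (Suc (Suc m))" "\<lambda>j. C j (Suc m)" "- Q 2 n" "- Q 1 n" "\<lambda>j. - Q j n" .
  have "\<forall>j\<in>J. - Q j n < 0" using Qn(3) by force
  then show ?thesis using triangles_uniform[OF _ assms] Qn by auto
qed

lemma Q_side:
  assumes "w \<in> {1..n}" "w \<noteq> 1" "w \<noteq> n"
  shows "weak_fork n w (mutate w Q)"
proof -
  obtain m where "cyclic_stage n Rt Q 2 1 a (\<lambda>j. C j (Suc (Suc m))) (\<lambda>j. C j (Suc m)) (- Q 2 n) (- Q 1 n) (\<lambda>j. - Q j n)"
    using Q_cyclic by blast
  then interpret cyclic_stage n Rt Q 2 1 a "\<lambda>j. C j (Suc (Suc m))" "\<lambda>j. C j (Suc m)" "- Q 2 n" "- Q 1 n" "\<lambda>j. - Q j n" .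
  have "\<forall>j\<in>J. - Q j n < 0" using Qn(3) by force
  then show ?thesis using fork_uniform[OF _ assms] Qn by auto
qed

text \<open>At \<open>S 1\<close> the vertex \<open>n\<close> is a source; from \<open>S 2\<close>
  on s -> n -> r holds, with weights from \<open>D\<close> that satisfy
  \<open>fork_mixed\<close>.\<close>

lemma S_side:
  assumes t: "t < 2 * k" and w: "w \<in> {1..n}" "w \<noteq> alt t" "w \<noteq> (if t = 0 then n else alt (t - 1))"
  shows "weak_fork n w (mutate w (S (Suc t)))"
proof -
  obtain m where m: "t + Suc m = 2 * k" using t by (metis add_Suc_right less_iff_Suc_add)
  have y: "\<forall>j\<in>J. Q j n > 0" using Qn(3) by force
  show ?thesis
  proof (cases t)
    case 0
    have "cyclic_stage n Rt (S (Suc 0)) 2 1 a (\<lambda>j. C j (Suc (Suc m))) (\<lambda>j. C j (Suc m)) (Q 2 n) (Q 1 n) (\<lambda>j. Q j n)"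
      by (rule stage_cyclic) (use described_S[OF m] 0 Q_abs in \<open>auto simp: alt_def D_0 D_1 simp del: One_nat_def\<close>)
    then interpret cyclic_stage n Rt "S (Suc 0)" 2 1 a "\<lambda>j. C j (Suc (Suc m))" "\<lambda>j. C j (Suc m)" "Q 2 n" "Q 1 n" "\<lambda>j. Q j n" .
    show ?thesis using fork_uniform[of w] y Qn_pos w 0 by (simp add: alt_def)
  next
    case (Suc t')
    have "cyclic_stage n Rt (S (Suc t)) (alt (Suc t)) (alt t) a (\<lambda>j. C j (Suc (Suc m))) (\<lambda>j. C j (Suc m)) (- D t) (D (Suc t)) (\<lambda>j. Q j n)"
      using D_ge[of t] D_ge[of t'] Q_abs(3) by (intro stage_cyclic described_S[OF m]) (auto simp: Suc)
    then interpret cyclic_stage n Rt "S (Suc t)" "alt (Suc t)" "alt t" a "\<lambda>j. C j (Suc (Suc m))" "\<lambda>j. C j (Suc m)" "- D t" "D (Suc t)" "\<lambda>j. Q j n" .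
    have "w \<noteq> alt (Suc t)" using w(3) Suc by (simp add: alt_def)
    then show ?thesis
      using fork_mixed[of w] y w D_ge[of t'] D_mono[of t'] D_gt_a[of t'] by (simp add: Suc)
  qed
qed

text \<open>\<open>T 1\<close> and \<open>T 2\<close> have the oriented triangles through
  \<open>n\<close> treated in \<open>fork_start\<close>; from \<open>T 3\<close> on the index of
  \<open>D\<close> is positive and \<open>fork_mixed\<close> applies.\<close>

lemma T_side:
  assumes t: "0 < t" "t < 2 * k" and w: "w \<in> {1..n}" "w \<noteq> alt t" "w \<noteq> alt (t - 1)"
  shows "weak_fork n w (mutate w (T t))"
proof -
  obtain m where m: "t + Suc m = 2 * k" using t by (metis add_Suc_right less_iff_Suc_add)
  have alt: "alt (t - 1) = alt (Suc t)" using t by (cases t) (auto simp: alt_def)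
  consider "t = Suc 0" | "t = Suc (Suc 0)" | t' where "t = Suc (Suc (Suc t'))"
    using t(1) by (metis gr0_conv_Suc old.nat.exhaust)
  then show ?thesis
  proof cases
    case 1
    have k2: "2 * k = Suc (Suc m)" using m 1 by simp
    then have k1: "2 * k - 1 = Suc m" by simp
    have "cyclic_stage n Rt (T (Suc 0)) 1 2 a (\<lambda>j. C j (Suc (Suc m))) (\<lambda>j. C j (Suc m)) (Q 1 n) (- Q 2 n)
        (\<lambda>j. - Q j n - Q 1 n * C j (Suc (Suc m)))"
      by (rule stage_cyclic[OF described_T1[unfolded k1, unfolded k2]])
         (use Qn Y_bounds(5) k2 in force)+
    then interpret cyclic_stage n Rt "T (Suc 0)" 1 2 a "\<lambda>j. C j (Suc (Suc m))" "\<lambda>j. C j (Suc m)" "Q 1 n" "- Q 2 n"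
        "\<lambda>j. - Q j n - Q 1 n * C j (Suc (Suc m))" .
    have "w \<noteq> 1" "w \<noteq> 2" using w 1 by (auto simp: alt_def)
    then have "weak_fork n w (mutate w (T (Suc 0)))"
      using Qn(1) Y_bounds(4,5)[unfolded k2] w(1) by (intro fork_start) (auto simp: add.commute)
    then show ?thesis using 1 by simp
  next
    case 2
    have k1: "2 * k - 1 = Suc (Suc m)" and k2: "2 * k - 2 = Suc m" using m 2 by auto
    have "cyclic_stage n Rt (T (Suc (Suc 0))) 2 1 a (\<lambda>j. C j (Suc (Suc m))) (\<lambda>j. C j (Suc m)) (Q 2 n) (Q 1 n) (\<lambda>j. - Y j)"
      by (rule stage_cyclic[OF described_T2[unfolded k1 k2]])
         (use Qn Y_bounds(3) in force)+
    then interpret cyclic_stage n Rt "T (Suc (Suc 0))" 2 1 a "\<lambda>j. C j (Suc (Suc m))" "\<lambda>j. C j (Suc m)" "Q 2 n" "Q 1 n" "\<lambda>j. - Y j" .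
    have "w \<noteq> 1" "w \<noteq> 2" using w 2 by (auto simp: alt_def)
    then have "weak_fork n w (mutate w (T (Suc (Suc 0))))"
      using Qn(2) Y_bounds(1,2)[unfolded k1] w(1) by (intro fork_start) auto
    then show ?thesis using 2 by simp
  next
    case 3
    have "Suc t' + Suc m + 2 = 2 * k" using m 3 by simp
    from described_T[OF this]
    have "cyclic_stage n Rt (T (Suc (Suc (Suc t')))) (alt (Suc (Suc t'))) (alt (Suc t')) a
        (\<lambda>j. C j (Suc (Suc m))) (\<lambda>j. C j (Suc m)) (- D (Suc t')) (D (Suc (Suc t'))) (\<lambda>j. - Y j)"
      by (rule stage_cyclic) (use D_ge[of t'] D_ge[of "Suc t'"] Y_bounds(3) in force)+
    then interpret cyclic_stage n Rt "T (Suc (Suc (Suc t')))" "alt (Suc (Suc t'))" "alt (Suc t')" a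
        "\<lambda>j. C j (Suc (Suc m))" "\<lambda>j. C j (Suc m)" "- D (Suc t')" "D (Suc (Suc t'))" "\<lambda>j. - Y j" .
    have "\<forall>j\<in>J. - Y j < 0" using Y_bounds(3) by force
    moreover have "w \<noteq> alt (Suc (Suc t'))" "w \<noteq> alt (Suc t')"
      using w 3 by (auto simp: alt_def)
    ultimately show ?thesis
      using fork_mixed[of w] w(1) D_ge[of t'] D_mono[of t'] D_gt_a[of t'] by (simp add: 3)
  qed
qed

section \<open>Telling the class of \<open>Q\<close> from the others\<close>

lemmas Q_entries = describedD[OF described_Q]

lemma extremal_vertexI:
  assumes "v \<in> {1..n}" "(\<forall>x. P v x \<le> 0) \<or> (\<forall>x. P v x \<ge> 0)"
  shows "\<not> no_extremal_vertex n P"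
  using assms unfolding no_extremal_vertex_def by (meson not_le)

lemma not_similar_extremal:
  assumes "\<not> no_extremal_vertex n P" "no_extremal_vertex n P'"
  shows "\<not> similar_quivers n P P'"
  using assms no_extremal_vertex_similar[OF similar_quivers_sym] by blast

lemma Q_cycle: "j \<in> J \<Longrightarrow> Q 1 2 > 0 \<and> Q 2 j > 0 \<and> Q j 1 > 0"
proof -
  assume j: "j \<in> J"
  obtain m where m: "2 * k = Suc m" using k by (cases "2 * k") auto
  show ?thesis
    using Q_entries(5) Q_entries(11,14)[OF j] a_pos C_pos[OF j] by (simp add: m)
qed

lemma Q_weights: "j \<in> J \<Longrightarrow> Q 1 2 < Q j 1 \<and> Q j 1 < Q 2 j"
proof -
  assume j: "j \<in> J"
  obtain m where m: "2 * k = Suc (Suc m)" using k by (cases "2 * k"; cases "2 * k - 1") auto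
  show ?thesis
    using Q_entries(5) Q_entries(11,14)[OF j] C_gt_a[OF j, of m] C_mono[OF j, of "Suc m"] by (simp add: m)
qed

text \<open>A point of return would lie on the triangle 1 -> 2 -> 3 -> 1, so it would have a
  predecessor and an arrow to \<open>n\<close>; a fork would then need an arrow out of the sink
  \<open>n\<close>.\<close>

lemma Q_not_fork: "\<not> weak_fork n r Q"
proof
  assume F: "weak_fork n r Q"
  have Q3: "Q 1 2 > 0" "Q 2 3 > 0" "Q 3 1 > 0" using Q_cycle[OF three] by auto
  then have "triangle Q 1 2 3" by (simp add: triangle_def)
  then have r: "r = 1 \<or> r = 2 \<or> r = 3" using F unfolding weak_fork_def by metis
  then obtain i where i: "Q i r > 0" using Q3 by blast
  have "Q r n > 0" using r Qn(1,2) Qn(3)[OF three] by auto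
  then have "Q n i > Q i r" using F i unfolding weak_fork_def by blast
  then show False using i Q_sink[of i] by simp
qed

lemma extremal_Q: "\<not> no_extremal_vertex n Q"
  using Q_sink n by (intro extremal_vertexI[of n]) auto

lemma S1_source: "S (Suc 0) n x \<ge> 0"
  using Q_sink[of x] by (simp add: S_1 mutate_n_Q)

lemma extremal_S1: "\<not> no_extremal_vertex n (S (Suc 0))"
  using S1_source n by (intro extremal_vertexI[of n]) auto

lemma extremal_R: "\<not> no_extremal_vertex n R"
proof -
  have J: "n - 1 \<in> J" using n by auto
  have "R (n - 1) x \<le> 0" for x
  proof (cases "x \<in> J")
    case True
    then have "x < n - 1 \<or> x = n - 1" by auto
    then show ?thesis using R_block(2)[OF True J] R_entries(10)[of x] by auto
  next
    case False
    then show ?thesis by (rule R_to_B[OF _ J])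
  qed
  moreover have "n - 1 \<in> {1..n}" using n by auto
  ultimately show ?thesis by (intro extremal_vertexI) auto
qed

text \<open>The second alternative in \<open>q\<close> serves the end \<open>T (2 * k)\<close>,
  where j -> r has turned into r -> j: there \<open>r\<close> needs its arrow from \<open>n\<close>,
  and the block its arrows to \<open>n\<close>.\<close>

lemma no_extremal_cycle:
  assumes P: "described n Rt P s r \<alpha> p q u v y" and \<alpha>: "\<alpha> < 0" and p: "\<And>j. j \<in> J \<Longrightarrow> p j > 0"
    and q: "(\<forall>j\<in>J. q j < 0) \<or> (v > 0 \<and> (\<forall>j\<in>J. y j < 0))"
    and uv: "u < 0 \<and> v > 0 \<or> (u > 0 \<or> v > 0) \<and> (\<forall>j\<in>J. y j < 0)"
  shows "no_extremal_vertex n P"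
proof (rule no_extremal_vertexI[OF P])
  note E = describedD[OF P]
  have E3: "P s 3 = p 3" "P r 3 = q 3" "P n 3 = y 3" "P 3 s = - p 3" "P 3 r = - q 3" "P 3 n = - y 3"
    using E(11-16)[OF three] by auto
  show "\<exists>x. P s x > 0" using E3 p[OF three] by metis
  show "\<exists>x. P s x < 0" using E(4) \<alpha> by metis
  show "\<exists>x. P r x > 0" using E(5) \<alpha> by (metis neg_0_less_iff_less)
  show "\<exists>x. P r x < 0" using q
  proof
    assume "\<forall>j\<in>J. q j < 0"
    then show ?thesis using E3 three by metis
  next
    assume "v > 0 \<and> (\<forall>j\<in>J. y j < 0)"
    then show ?thesis using E(9) by (metis neg_less_0_iff_less)
  qed
  show "\<exists>x. P n x > 0" using uv E(6,8) by metis
  show "\<exists>x. P n x < 0" using uv E(6) E3 three by metis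
  fix j assume j: "j \<in> J"
  show "\<exists>x. P j x < 0" using E(12)[OF j] p[OF j] by (metis neg_less_0_iff_less)
  show "\<exists>x. P j x > 0" using q
  proof
    assume "\<forall>j\<in>J. q j < 0"
    then show ?thesis using E(14)[OF j] j by (metis neg_0_less_iff_less)
  next
    assume "v > 0 \<and> (\<forall>j\<in>J. y j < 0)"
    then show ?thesis using E(16)[OF j] j by (metis neg_0_less_iff_less)
  qed
qed

lemma no_extremal_S: "0 < t \<Longrightarrow> t < 2 * k \<Longrightarrow> no_extremal_vertex n (S (Suc t))"
proof -
  assume t: "0 < t" "t < 2 * k"
  obtain m where m: "t + Suc m = 2 * k" using t(2) by (metis add_Suc_right less_iff_Suc_add)
  obtain t' where t': "t = Suc t'" using t(1) gr0_conv_Suc by blast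
  show ?thesis
    using a_pos C_pos D_pos[of t'] D_pos[of t]
    by (intro no_extremal_cycle[OF described_S[OF m]]) (auto simp: t')
qed

lemma no_extremal_T: "0 < t \<Longrightarrow> t \<le> 2 * k \<Longrightarrow> no_extremal_vertex n (T t)"
proof -
  assume t: "0 < t" "t \<le> 2 * k"
  show ?thesis
  proof (cases "t = Suc 0")
    case True
    obtain m where m: "2 * k = Suc (Suc m)" using k by (cases "2 * k"; cases "2 * k - 1") auto
    then have m': "2 * k - 1 = Suc m" by simp
    have y: "- Q j n - Q 1 n * C j (Suc (Suc m)) < 0" if "j \<in> J" for j
      using Y_bounds(5)[OF that] Qn(1) unfolding m by linarith
    show ?thesis
      unfolding True
    proof (rule no_extremal_cycle[OF described_T1[unfolded m', unfolded m]])
      show "- a < 0" using a_pos by simp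
      show "C j (Suc (Suc m)) > 0" if "j \<in> J" for j by (rule C_pos[OF that])
      show "(\<forall>j\<in>J. - C j (Suc m) < 0) \<or> (- Q 2 n > 0 \<and> (\<forall>j\<in>J. - Q j n - Q 1 n * C j (Suc (Suc m)) < 0))"
        using C_pos by simp
      show "Q 1 n < 0 \<and> - Q 2 n > 0 \<or> (Q 1 n > 0 \<or> - Q 2 n > 0) \<and> (\<forall>j\<in>J. - Q j n - Q 1 n * C j (Suc (Suc m)) < 0)"
        using y Qn_pos(1) by blast
    qed
  next
    case False
    define t' where "t' = t - 2"
    have t': "t = Suc (Suc t')" using t(1) False by (simp add: t'_def)
    define m where "m = 2 * k - t"
    have m: "t' + m + 2 = 2 * k" using t(2) t' by (simp add: m_def)
    have y: "\<forall>j\<in>J. - Y j < 0" using Y_bounds(3) by force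
    show ?thesis
      unfolding t'
    proof (rule no_extremal_cycle[OF described_T[OF m]])
      show "- a < 0" using a_pos by simp
      show "C j (Suc m) > 0" if "j \<in> J" for j by (rule C_pos[OF that])
    qed (use y D_pos[of t'] in blast)+
  qed
qed

lemma no_extremal_N2: "no_extremal_vertex n (mutate 2 (N 3))"
proof (rule no_extremal_vertexI[OF described_N2])
  let ?P = "mutate 2 (N 3)"
  note E = describedD[OF described_N2]
  have D: "D (2 * k) > 0" "D (2 * k - 1) > 0" using D_2k by auto
  have R: "Rt 1 j > 0" "Rt 2 j > 0" if "j \<in> J" for j using Rt_B(1,2)[OF that] by auto
  show "\<exists>x. ?P 2 x > 0" using E(4) a_pos by (intro exI[of _ 1]) linarith
  show "\<exists>x. ?P 2 x < 0" using E(7) D by (intro exI[of _ n]) linarith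
  show "\<exists>x. ?P 1 x > 0" using E(9) D by (intro exI[of _ n]) linarith
  show "\<exists>x. ?P 1 x < 0" using E(5) a_pos by (intro exI[of _ 2]) linarith
  show "\<exists>x. ?P n x > 0" using E(6) D by (intro exI[of _ 2]) linarith
  show "\<exists>x. ?P n x < 0" using E(8) D by (intro exI[of _ 1]) linarith
  fix j assume j: "j \<in> J"
  show "\<exists>x. ?P j x > 0" using E(14)[OF j] R[OF j] by (intro exI[of _ 1]) linarith
  show "\<exists>x. ?P j x < 0" using E(12)[OF j] R[OF j] by (intro exI[of _ 2]) linarith
qed

text \<open>Recovers the vertices 1 and 2 from the order of the weights alone, which pins down any
  relabeling there.\<close>

lemma Q_increasing_triangle:
  assumes "triangle Q x y z" "Q x y < Q y z" "Q x y < Q z x"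
  shows "x = 1 \<and> y = 2 \<and> z \<in> J \<and> Q z x < Q y z"
proof -
  obtain j where j: "j \<in> J" "(x, y, z) = (2, j, 1) \<or> (x, y, z) = (j, 1, 2) \<or> (x, y, z) = (1, 2, j)"
    using Q_triangle[OF assms(1)] by blast
  from j(2) show ?thesis
    using assms(2,3) Q_weights[OF j(1)] j(1) by (elim disjE) auto
qed

lemma Q_inner_in: "z \<in> {1..n} \<Longrightarrow> z \<noteq> n \<Longrightarrow> \<exists>x. x \<noteq> n \<and> Q z x < 0"
proof -
  assume z: "z \<in> {1..n}" "z \<noteq> n"
  have neg: "Q x y > 0 \<Longrightarrow> Q y x < 0" for x y
    using quiver_on_skew[OF Q, of x y] by linarith
  have "Q 1 3 < 0" "Q 2 1 < 0" "z \<in> J \<Longrightarrow> Q z 2 < 0"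
    using neg Q_cycle[OF three] Q_cycle[of z] by blast+
  moreover have "3 \<noteq> n" "1 \<noteq> n" "2 \<noteq> n" using n by auto
  moreover have "z = 1 \<or> z = 2 \<or> z \<in> J" using vertex_cases[OF z(1)] z(2) by blast
  ultimately show ?thesis by metis
qed

lemma Q_inner_out: "z \<in> {1..n} \<Longrightarrow> z \<noteq> n \<Longrightarrow> \<exists>x. x \<noteq> n \<and> Q z x > 0"
proof -
  assume z: "z \<in> {1..n}" "z \<noteq> n"
  have "Q 1 2 > 0" "Q 2 3 > 0" "z \<in> J \<Longrightarrow> Q z 1 > 0"
    using Q_cycle[OF three] Q_cycle[of z] by blast+
  moreover have "3 \<noteq> n" "1 \<noteq> n" "2 \<noteq> n" using n by auto
  moreover have "z = 1 \<or> z = 2 \<or> z \<in> J" using vertex_cases[OF z(1)] z(2) by blast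
  ultimately show ?thesis by metis
qed

text \<open>The oriented triangles of \<open>Q\<close> all have the same cyclic order of weights (smallest, largest,
  middle), which reversal changes to (smallest, middle, largest).\<close>

lemma S1_not_similar: "\<not> similar_quivers n Q (S (Suc 0))"
proof
  assume "similar_quivers n Q (S (Suc 0))"
  then obtain \<sigma> \<epsilon> where *: "\<sigma> permutes {1..n}" "\<epsilon> = 1 \<or> \<epsilon> = - 1" "S (Suc 0) = (\<lambda>i j. \<epsilon> * Q (\<sigma> i) (\<sigma> j))"
    unfolding similar_quivers_def by blast
  have eq: "S (Suc 0) i j = \<epsilon> * Q (\<sigma> i) (\<sigma> j)" for i j by (simp add: *(3))
  from *(2) show False
  proof
    \<comment> \<open>Without reversal, the source \<open>n\<close> of \<open>S 1\<close> would give
      a source of \<open>Q\<close>, which has none.\<close>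
    assume \<epsilon>: "\<epsilon> = 1"
    have src: "Q (\<sigma> n) x \<ge> 0" for x
      using S1_source[of "inv \<sigma> x"] permutes_inverses(1)[OF *(1), of x] eq[of n "inv \<sigma> x"] \<epsilon> by simp
    have "\<sigma> n \<in> {1..n}" using permutes_in_image[OF *(1), of n] n by auto
    moreover have "Q n 1 < 0" using Qn(1) quiver_on_skew[OF Q, of n 1] by simp
    ultimately have "\<exists>x. Q (\<sigma> n) x < 0" using Q_inner_in[of "\<sigma> n"] by metis
    then show False using src by (metis not_less)
  next
    assume \<epsilon>: "\<epsilon> = - 1"
    have "3 \<noteq> n" "1 \<noteq> n" "2 \<noteq> n" using n by auto
    then have S: "S (Suc 0) 1 2 = Q 1 2" "S (Suc 0) 2 3 = Q 2 3" "S (Suc 0) 3 1 = Q 3 1"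
      by (simp_all add: S_1 mutate_n_Q)
    have neg: "Q (\<sigma> y) (\<sigma> x) = S (Suc 0) x y" for x y
      using eq[of x y] quiver_on_skew[OF Q, of "\<sigma> y" "\<sigma> x"] \<epsilon> by simp
    have t: "triangle Q (\<sigma> 2) (\<sigma> 1) (\<sigma> 3)"
      unfolding triangle_def neg S using Q_cycle[OF three] by blast
    have "Q (\<sigma> 3) (\<sigma> 2) < Q (\<sigma> 1) (\<sigma> 3)"
      using Q_increasing_triangle[OF t] Q_weights[OF three] unfolding neg S by linarith
    then show False using Q_weights[OF three] unfolding neg S by linarith
  qed
qed

text \<open>Unreversed, the triangle 1 -> 2 -> n -> 1 has weights in the order smallest, middle,
  largest, which does not occur in \<open>Q\<close>. Reversed, the sink \<open>n\<close> of
  \<open>Q\<close> must correspond to a source of \<open>N l\<close>, and only \<open>l\<close> can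
  be one; the rest is compared with \<open>Q\<close> without \<open>n\<close>, which has neither
  source nor sink.\<close>

lemma N_not_similar:
  assumes l: "l \<in> {3..n}" and n4: "n \<ge> 5 \<or> n = 4 \<and> Q 1 4 \<noteq> R 2 3"
  shows "\<not> similar_quivers n Q (N l)"
proof
  assume "similar_quivers n Q (N l)"
  then obtain \<sigma> \<epsilon> where *: "\<sigma> permutes {1..n}" "\<epsilon> = 1 \<or> \<epsilon> = - 1" "N l = (\<lambda>i j. \<epsilon> * Q (\<sigma> i) (\<sigma> j))"
    unfolding similar_quivers_def by blast
  have eq: "N l i j = \<epsilon> * Q (\<sigma> i) (\<sigma> j)" for i j by (simp add: *(3))
  have N: "N l 1 2 = a" "N l 2 n = D (2 * k)" "N l n 1 = D (Suc (2 * k))"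
    using N_entries[OF l] R_entries(5,7,8) by auto
  have Nneg: "N l 2 1 < 0" "N l n 2 < 0" "N l 1 n < 0"
    using N_entries[OF l] R_entries(4,6,9) a_pos D_2k by auto
  from *(2) show False
  proof
    assume "\<epsilon> = 1"
    then have QN: "Q (\<sigma> x) (\<sigma> y) = N l x y" for x y using eq[of x y] by simp
    have t: "triangle Q (\<sigma> 1) (\<sigma> 2) (\<sigma> n)"
      unfolding triangle_def QN N using a_pos D_2k by auto
    show False
      using Q_increasing_triangle[OF t] D_2k unfolding QN N by linarith
  next
    assume \<epsilon>: "\<epsilon> = - 1"
    have QN: "Q (\<sigma> y) (\<sigma> x) = N l x y" for x y
      using eq[of x y] quiver_on_skew[OF Q, of "\<sigma> y" "\<sigma> x"] \<epsilon> by simp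
    have QN': "Q (\<sigma> x) (\<sigma> y) = - N l x y" for x y
      using eq[of x y] \<epsilon> by simp
    define v where "v = inv \<sigma> n"
    have \<sigma>v: "\<sigma> v = n" using permutes_inverses(1)[OF *(1)] by (simp add: v_def)
    have v: "v \<in> {1..n}" using permutes_in_image[OF *(1), of v] \<sigma>v n by simp
    have src: "N l v x \<ge> 0" for x
      using QN'[of v x] Q_sink[of "\<sigma> x"] \<sigma>v by simp
    have vl: "v = l \<and> l \<in> J"
      using v
    proof (cases rule: vertex_cases)
      case 4
      have "\<not> v < l"
      proof
        assume "v < l"
        then have "N l v 1 = R v 1" using l by (simp add: N_def)
        then show False using src[of 1] R_to_B_less[OF _ 4, of 1] by simp
      qed
      moreover have "\<not> l < v"
      proof
        assume "l < v"
        moreover from this have "l \<in> J" using l 4 by auto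
        ultimately show False
          using src[of l] R_block(2)[of l v] 4 by (simp add: N_def)
      qed
      ultimately show ?thesis using 4 by auto
    qed (use src Nneg in \<open>metis not_less\<close>)+
    have ne_n: "\<sigma> x \<noteq> n" if "x \<noteq> l" for x
      using that vl \<sigma>v permutes_inj[OF *(1)] by (metis injD)
    have range: "x \<in> J \<Longrightarrow> \<sigma> x \<in> {1..n}" for x
      using permutes_in_image[OF *(1), of x] by auto
    have surj: "\<exists>x'. \<sigma> x' = x" for x using permutes_inverses(1)[OF *(1)] by blast
    show False
      using n4
    proof
      assume n5: "n \<ge> 5"
      show False
      proof (cases "l = n - 1")
        case True
        \<comment> \<open>Only n - 1 has been reversed: deleting it leaves the sink n - 2, a block
          vertex because n is at least 5.\<close>
        define w where "w = n - 2"
        have w: "w \<in> J" "w < l" using n5 True by (auto simp: w_def)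
        have "N l w x \<le> 0" if "x \<noteq> l" for x
        proof (cases "x \<in> J")
          case xJ: True
          then have "x < l" using that True by auto
          then have "N l w x = R w x" using w by (simp add: N_def)
          moreover have "x \<le> w" using \<open>x < l\<close> True by (simp add: w_def)
          ultimately show ?thesis
            using R_block(2)[OF xJ w(1)] R_entries(10)[of w] by (cases "x = w") auto
        next
          case False
          then have "N l w x = R w x" using w l by (auto simp: N_def)
          then show ?thesis using R_to_B[OF False w(1)] by simp
        qed
        moreover obtain x where x: "x \<noteq> n" "Q (\<sigma> w) x < 0"
          using Q_inner_in[OF range[OF w(1)] ne_n] w by blast
        moreover obtain x' where "\<sigma> x' = x" using surj by blast
        ultimately show False
          using QN'[of w x'] vl \<sigma>v by (metis neg_less_0_iff_less not_less)
      next
        case False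
        \<comment> \<open>All block vertices from \<open>l\<close> on have been reversed: after
          deleting \<open>l\<close>, the next one is a source.\<close>
        define w where "w = Suc l"
        have w: "w \<in> J" "w > l" using False vl by (auto simp: w_def)
        have "N l w x \<ge> 0" if "x \<noteq> l" for x
        proof (cases "x \<in> J")
          case xJ: True
          show ?thesis
          proof (cases "x < l")
            case True
            then have "N l w x = - R w x" using w by (simp add: N_def)
            then show ?thesis using R_block(2)[OF xJ w(1)] True w by simp
          next
            case False
            then have "N l w x = R w x" using w xJ by (simp add: N_def)
            moreover have "w \<le> x" using that False by (simp add: w_def)
            ultimately show ?thesis
              using R_block(1)[OF w(1) xJ] R_entries(10)[of w] by (cases "x = w") auto
          qed
        next
          case False
          then have "N l w x = - R w x" using w l by (auto simp: N_def)
          then show ?thesis using R_to_B[OF False w(1)] by simp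
        qed
        moreover obtain x where x: "x \<noteq> n" "Q (\<sigma> w) x > 0"
          using Q_inner_out[OF range[OF w(1)] ne_n] w by blast
        moreover obtain x' where "\<sigma> x' = x" using surj by blast
        ultimately show False
          using QN'[of w x'] vl \<sigma>v by (metis neg_0_less_iff_less not_less)
      qed
    next
      assume n4: "n = 4 \<and> Q 1 4 \<noteq> R 2 3"
      then have l3: "l = 3" using vl by auto
      \<comment> \<open>For n = 4 the rest is this oriented triangle, without source or sink. The
        order of its weights forces \<open>\<sigma> 2 = 1\<close>, and the entry between 2 and
        \<open>l = 3\<close> gives the excluded equation.\<close>
      have t: "triangle Q (\<sigma> 2) (\<sigma> 1) (\<sigma> n)"
        unfolding triangle_def QN N using a_pos D_2k by auto
      have "\<sigma> 2 = 1"
        using Q_increasing_triangle[OF t] D_2k unfolding QN N by linarith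
      moreover have "N l 2 3 = - R 2 3" using l3 n by (simp add: N_def)
      ultimately have "Q n 1 = - R 2 3"
        using QN[of 3 2] \<sigma>v vl l3 by simp
      then show False using quiver_on_skew[OF Q, of 1 n] n4 by (metis minus_minus)
    qed
  qed
qed

lemma no_short_cycle_through_Q:
  assumes "graph_cycle (Gamma_edges n Q) c" "length c \<le> 4 * k + 1"
  shows "quiver_class n Q \<notin> set c"
proof (rule no_short_cycle[OF Q Q_not_fork, where S = S and T = T and Ma = "2 * k + 1" and Mb = "2 * k"
      and va = "\<lambda>t. if t = 0 then n else alt (t - 1)" and vb = alt and B = "4 * k + 1"])
  show "weak_fork n j (mutate j Q)" if "j \<in> {1..n}" "j \<noteq> (if 0 = (0::nat) then n else alt (0 - 1))" "j \<noteq> alt 0" for j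
    using Q_side[of j] that by (simp add: alt_def)
  show "S (Suc t) = mutate (if t = 0 then n else alt (t - 1)) (S t)" for t
    by (cases t) (simp_all add: S_0 S_1 S_Suc)
  show "weak_fork n j (mutate j (S t))"
    if "0 < t" "t < 2 * k + 1" "j \<in> {1..n}" "j \<noteq> (if t - 1 = 0 then n else alt (t - 1 - 1))"
      "j \<noteq> (if t = 0 then n else alt (t - 1))" for t j
    using S_side[of "t - 1" j] that by (cases t) auto
  show "weak_fork n j (mutate j (T t))" if "0 < t" "t < 2 * k" "j \<in> {1..n}" "j \<noteq> alt (t - 1)" "j \<noteq> alt t" for t j
    by (rule T_side) (use that in auto)
  show "\<exists>s\<le>2 * k + 1. \<exists>t\<le>2 * k. s + t = l \<and> \<not> similar_quivers n (S s) (T t)" if l: "3 \<le> l" "l \<le> 4 * k + 1" for l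
  proof (cases "l \<le> 2 * k + 1")
    case True
    have "no_extremal_vertex n (T (l - 1))"
      by (rule no_extremal_T) (use l True in auto)
    then have "\<not> similar_quivers n (S 1) (T (l - 1))"
      unfolding One_nat_def by (rule not_similar_extremal[OF extremal_S1])
    then show ?thesis using l True k by (intro exI[of _ 1] conjI exI[of _ "l - 1"]) auto
  next
    case False
    have "no_extremal_vertex n (T (l - (2 * k + 1)))"
      by (rule no_extremal_T) (use l False in auto)
    then have "\<not> similar_quivers n R (T (l - (2 * k + 1)))"
      by (rule not_similar_extremal[OF extremal_R])
    then show ?thesis
      using l False by (intro exI[of _ "2 * k + 1"] conjI exI[of _ "l - (2 * k + 1)"]) (auto simp: R_def)
  qed
qed (use assms k in \<open>simp_all add: S_0 T_0 T_Suc\<close>)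

section \<open>Quivers visited by the long mutation cycle\<close>

lemma R_eq: "mutate_seq (alternating 1 2 (2 * k)) (mutate n Q) = R"
  by (simp add: R_def S_def)

lemma rev_upt: "rev [1..<n] = rev [3..<n] @ [2, 1]"
proof -
  have "[1..<n] = 1 # 2 # [3..<n]"
    using n by (simp add: upt_conv_Cons numeral_2_eq_2 numeral_3_eq_3)
  then show ?thesis by simp
qed

lemma N3_eq: "mutate_seq (rev [3..<n]) R = N 3"
  by (rule N_eq) (use n in auto)

definition tail :: "quiver list" where
  "tail = mutation_path (alternating 1 2 (2 * k) @ rev [1..<n] @ alternating 2 1 (2 * k)) (mutate n Q)"

lemma tail_eq:
  "tail = mutation_path (alternating 1 2 (2 * k)) (mutate n Q) @ mutation_path (rev [3..<n]) R @
     [N 3, mutate 2 (N 3)] @ mutation_path (alternating 2 1 (2 * k)) (T (2 * k))"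
  unfolding tail_def rev_upt
  by (simp add: mutation_path_append mutation_path_Cons mutation_path_Nil R_eq N3_eq N1_eq_T del: One_nat_def)

lemma returning: "m \<le> 2 * k \<Longrightarrow> mutate_seq (take m (alternating 2 1 (2 * k))) (T (2 * k)) = T (2 * k - m)"
  using mutate_seq_take_rev[OF Q, of m "alternating 1 2 (2 * k)"]
  by (simp add: T_def rev_alternating take_alternating)

lemma full_cycle:
  "mutate_seq (n # alternating 1 2 (2 * k) @ rev [1..<n] @ alternating 2 1 (2 * k)) Q = Q"
  using returning[of "2 * k"]
  by (simp add: rev_upt R_eq N3_eq N1_eq_T T_0 take_alternating del: One_nat_def)

text \<open>Most of these quivers have no source or sink, unlike \<open>Q\<close>. The exceptions
  are \<open>S 1\<close> and the quivers \<open>N l\<close>, among them \<open>R\<close>, which need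
  the order of weights.\<close>

lemma tail_not_similar:
  assumes n4: "n \<ge> 5 \<or> n = 4 \<and> Q 1 4 \<noteq> R 2 3" and P: "P \<in> set tail"
  shows "\<not> similar_quivers n Q P"
proof -
  have no: "\<not> similar_quivers n Q P" if "no_extremal_vertex n P" for P
    using that by (rule not_similar_extremal[OF extremal_Q])
  consider "P \<in> set (mutation_path (alternating 1 2 (2 * k)) (mutate n Q))"
    | "P \<in> set (mutation_path (rev [3..<n]) R)" | "P = N 3" | "P = mutate 2 (N 3)"
    | "P \<in> set (mutation_path (alternating 2 1 (2 * k)) (T (2 * k)))"
    using P unfolding tail_eq by auto
  then show ?thesis
  proof cases
    case 1
    then obtain t where "t < 2 * k" "P = S (Suc t)"
      by (auto simp: in_mutation_path take_alternating S_def)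
    then show ?thesis
      using no[OF no_extremal_S[of t]] S1_not_similar by (cases t) auto
  next
    case 2
    then obtain m where m: "m < n - 3" "P = mutate_seq (take m (rev [3..<n])) R"
      by (auto simp: in_mutation_path)
    have "take m (rev [3..<n]) = rev [n - m..<n]"
      using m(1) by (simp add: take_rev)
    then have "P = N (n - m)" using m N_eq[of "n - m"] by simp
    then show ?thesis using N_not_similar[of "n - m"] n4 m(1) by auto
  next
    case 3
    then show ?thesis using N_not_similar[of 3] n4 n by auto
  next
    case 4
    then show ?thesis using no[OF no_extremal_N2] by simp
  next
    case 5
    then obtain m where "m < 2 * k" "P = T (2 * k - m)"
      using returning by (auto simp: in_mutation_path)
    then show ?thesis using no[OF no_extremal_T[of "2 * k - m"]] by simp
  qed
qed

text \<open>The two neighbours of \<open>Q\<close> on the long cycle, needed to see that the cycle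
  does not return along its first edge.\<close>

lemma hd_tail: "hd tail = S (Suc 0)" and last_tail: "last tail = T (Suc 0)" and tail_ne: "tail \<noteq> []"
proof -
  obtain m where m: "2 * k = Suc m" using k by (cases "2 * k") auto
  have "alternating 1 2 (2 * k) = 1 # map (\<lambda>i. if even (Suc i) then 1 else 2) [0..<m]"
    unfolding m alternating_def by (simp add: upt_conv_Cons map_Suc_upt[symmetric] del: upt_Suc)
  then show "hd tail = S (Suc 0)"
    by (simp add: tail_def mutation_path_Cons S_1)
  have "last (mutation_path (alternating 2 1 (2 * k)) (T (2 * k))) = mutate_seq (take m (alternating 2 1 (2 * k))) (T (2 * k))"
    by (simp add: mutation_path_def m del: alternating_Suc)
  also have "\<dots> = T (Suc 0)" using returning[of m] m by simp
  finally have "last (mutation_path (alternating 2 1 (2 * k)) (T (2 * k))) = T (Suc 0)" .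
  moreover have "mutation_path (alternating 2 1 (2 * k)) (T (2 * k)) \<noteq> []"
    using m by (simp add: mutation_path_def)
  ultimately show "last tail = T (Suc 0)" by (simp add: tail_eq)
  show "tail \<noteq> []" by (simp add: tail_eq)
qed

lemma not_paved:
  assumes n4: "n \<ge> 5 \<or> n = 4 \<and> Q 1 4 \<noteq> R 2 3"
  shows "\<not> paved_by_cycles (Gamma_verts n Q) (Gamma_edges n Q) (4 * k + 1) (quiver_class n Q # map (quiver_class n) tail)"
proof (rule not_paved_by_cycles)
  show "u \<noteq> v" if "{u, v} \<in> Gamma_edges n Q" for u v using that by (rule Gamma_edges_irrefl)
  show "quiver_class n Q \<notin> set c" if "graph_cycle (Gamma_edges n Q) c" "length c \<le> 4 * k + 1" for c
    by (rule no_short_cycle_through_Q[OF that])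
  show "quiver_class n Q \<notin> set (map (quiver_class n) tail)"
    using tail_not_similar[OF n4] by (auto simp: quiver_class_eq_iff)
  show "map (quiver_class n) tail \<noteq> []" using tail_ne by simp
  have "\<not> similar_quivers n (T (Suc 0)) (S (Suc 0))"
    using no_extremal_T[of "Suc 0"] k extremal_S1 no_extremal_vertex_similar by force
  then show "last (map (quiver_class n) tail) \<noteq> hd (map (quiver_class n) tail)"
    using tail_ne by (simp add: last_map hd_map hd_tail last_tail quiver_class_eq_iff)
qed

end

theorem theorem7p2:
  fixes n k :: nat and Rt Q R :: quiver and ms :: "nat list"
  assumes "n \<ge> 4" and "k \<ge> 1"
    and "quiver_on (n - 1) Rt"
    and "\<And>i j. i \<in> {1..n-1} \<Longrightarrow> j \<in> {1..n-1} \<Longrightarrow> i < j \<Longrightarrow> Rt i j \<ge> 2"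
    and "quiver_on n Q"
    and "full_subquiver {1..n-1} Q = mutate_seq (concat (replicate k [2, 1])) Rt"
    and "\<And>i. i \<in> {1..n-1} \<Longrightarrow> Q i n \<ge> 2"
    and "R = mutate_seq (n # concat (replicate k [1, 2])) Q"
    and "n \<ge> 5 \<or> (n = 4 \<and> Q 1 4 \<noteq> R 2 3)"
    and "ms = n # concat (replicate k [1, 2]) @ rev [1..<n] @ concat (replicate k [2, 1])"
  shows "(\<nexists>c. graph_cycle (Gamma_edges n Q) c \<and> length c \<le> 4 * k + 1 \<and>
               quiver_class n Q \<in> set c) \<and>
         length ms = 4 * k + n \<and> mutate_seq ms Q = Q \<and>
         \<not> paved_by_cycles (Gamma_verts n Q) (Gamma_edges n Q) (4 * k + 1)
             (map (quiver_class n) (mutation_path ms Q))"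
proof -
  interpret long_cycle n k Rt Q
    by unfold_locales (use assms in auto)
  have R: "R = local.R"
    using assms(8) R_eq by (simp add: concat_replicate_alternating)
  have ms: "ms = n # alternating 1 2 (2 * k) @ rev [1..<n] @ alternating 2 1 (2 * k)"
    using assms(10) by (simp only: concat_replicate_alternating)
  have "length ms = 4 * k + n" using n by (simp add: ms)
  moreover have "mutate_seq ms Q = Q" unfolding ms by (rule full_cycle)
  moreover have "map (quiver_class n) (mutation_path ms Q) = quiver_class n Q # map (quiver_class n) tail"
    by (simp add: ms mutation_path_Cons tail_def)
  ultimately show ?thesis
    using no_short_cycle_through_Q not_paved assms(9) unfolding R by metis
qed

end
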